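(* There is a linear-time algorithm for the Wheeler Subgraph (WS) problem which, on an input graph with edge label alphabet of size $\sigma$, outputs a set $E''\subseteq E$ such that $(V,E'')$ is a Wheeler graph and $|E''|\geq \frac{c}{\sigma}|E^*|$, where $|E^*|$ is the optimal value and $c>0$ is an absolute constant (an $\Omega(1/\sigma)$-approximation).
   Context: A directed edge-labeled graph $G=(V,E)$ has edge set $E$ consisting of triples $(u,v,k)$ (a directed edge from $u$ to $v$ with label $k\in\{1,\dots,\sigma\}$, labels ordered as integers; $E$ is a set). $G$ is a Wheeler graph if there is a total ordering $<_\pi$ of $V$ such that for any two edges $(u,v,k)$ and $(u',v',k')$: (i) $k<k'$ implies $v<_\pi v'$; (ii) $k=k'$ and $u<_\pi u'$ imply $v\leq_\pi v'$; and in addition every vertex of in-degree zero precedes every vertex of positive in-degree in $<_\pi$. The WS problem: given $G=(V,E)$, find a largest $E''\subseteq E$ such that $(V,E'')$ is a Wheeler graph. *)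

theory Defs
  imports Complex_Main
begin

section \<open>Wheeler graphs\<close>

type_synonym 'v edge = "'v \<times> 'v \<times> nat"

definition labeled_graph :: "'v set \<Rightarrow> nat \<Rightarrow> 'v edge set \<Rightarrow> bool" where
  "labeled_graph V \<sigma> E \<longleftrightarrow> finite V \<and> E \<subseteq> V \<times> V \<times> {1..\<sigma>}"

definition in_degree :: "'v edge set \<Rightarrow> 'v \<Rightarrow> nat" where
  "in_degree E v = card {(u, w, k) \<in> E. w = v}"

text \<open>The pair \<open>(u, v) \<in> r\<close> means that \<open>u\<close> strictly precedes \<open>v\<close>.\<close>

definition wheeler_order :: "'v set \<Rightarrow> 'v edge set \<Rightarrow> 'v rel \<Rightarrow> bool" where
  "wheeler_order V E r \<longleftrightarrow>
     strict_linear_order_on V r \<and>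
     (\<forall>u\<in>V. \<forall>v\<in>V. in_degree E u = 0 \<and> in_degree E v > 0 \<longrightarrow> (u, v) \<in> r) \<and>
     (\<forall>u v k u' v' k'. (u, v, k) \<in> E \<and> (u', v', k') \<in> E \<longrightarrow>
        (k < k' \<longrightarrow> (v, v') \<in> r) \<and>
        (k = k' \<and> (u, u') \<in> r \<longrightarrow> v = v' \<or> (v, v') \<in> r))"

definition wheeler_graph :: "'v set \<Rightarrow> 'v edge set \<Rightarrow> bool" where
  "wheeler_graph V E \<longleftrightarrow> (\<exists>r. wheeler_order V E r)"

definition ws_feasible :: "'v set \<Rightarrow> 'v edge set \<Rightarrow> 'v edge set \<Rightarrow> bool" where
  "ws_feasible V E E'' \<longleftrightarrow> E'' \<subseteq> E \<and> wheeler_graph V E''"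

text \<open>For finite \<open>E\<close> the maximum is over a finite nonempty set, as \<open>{}\<close> is always feasible
  when \<open>V\<close> is finite.\<close>

definition ws_opt :: "'v set \<Rightarrow> 'v edge set \<Rightarrow> nat" where
  "ws_opt V E = Max (card ` {E''. ws_feasible V E E''})"


section \<open>A word RAM\<close>

text \<open>Programs are structured three-address code over finitely many named registers and named
  arrays (a program can only mention finitely many of either; interleaving the arrays in one
  memory changes running times by a constant factor only). Every instruction and every test
  costs one time step.

  The parameter \<open>W\<close> of the semantics is the number of distinct machine words: an instruction
  whose result is not below \<open>W\<close> gets stuck, and a stuck or nonterminating run has no derivation.
  So unit-cost arithmetic cannot be used to build large numbers. Subtraction is truncated.\<close>

type_synonym name = string

record state =
  regs :: "name \<Rightarrow> nat"
  arrs :: "name \<Rightarrow> nat \<Rightarrow> nat"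

datatype rhs =
    Const nat
  | Reg name
  | Add name name
  | Sub name name
  | Load name name  \<comment> \<open>array, register holding the index\<close>

datatype com =
    Skip
  | Assign name rhs
  | Store name name name  \<comment> \<open>array, register holding the index, register holding the value\<close>
  | Seq com com
  | IfLess name name com com
  | WhileLess name name com

fun rhs_val :: "rhs \<Rightarrow> state \<Rightarrow> nat" where
  "rhs_val (Const c) s = c"
| "rhs_val (Reg x) s = regs s x"
| "rhs_val (Add x y) s = regs s x + regs s y"
| "rhs_val (Sub x y) s = regs s x - regs s y"
| "rhs_val (Load a x) s = arrs s a (regs s x)"

text \<open>\<open>exec W p s t s'\<close>: on words below \<open>W\<close>, program \<open>p\<close> started in \<open>s\<close> halts in \<open>s'\<close> after
  exactly \<open>t\<close> steps.\<close>

inductive exec :: "nat \<Rightarrow> com \<Rightarrow> state \<Rightarrow> nat \<Rightarrow> state \<Rightarrow> bool" for W :: nat where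
  Skip: "exec W Skip s 1 s"
| Assign: "rhs_val e s < W \<Longrightarrow>
    exec W (Assign x e) s 1 (s\<lparr>regs := (regs s)(x := rhs_val e s)\<rparr>)"
| Store:
    "exec W (Store a x y) s 1
       (s\<lparr>arrs := (arrs s)(a := (arrs s a)(regs s x := regs s y))\<rparr>)"
| Seq: "exec W p s t1 s1 \<Longrightarrow> exec W q s1 t2 s2 \<Longrightarrow> exec W (Seq p q) s (t1 + t2) s2"
| IfTrue: "regs s x < regs s y \<Longrightarrow> exec W p s t s' \<Longrightarrow> exec W (IfLess x y p q) s (1 + t) s'"
| IfFalse: "\<not> regs s x < regs s y \<Longrightarrow> exec W q s t s' \<Longrightarrow> exec W (IfLess x y p q) s (1 + t) s'"
| WhileTrue: "regs s x < regs s y \<Longrightarrow> exec W p s t1 s1 \<Longrightarrow>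
    exec W (WhileLess x y p) s1 t2 s2 \<Longrightarrow> exec W (WhileLess x y p) s (1 + t1 + t2) s2"
| WhileFalse: "\<not> regs s x < regs s y \<Longrightarrow> exec W (WhileLess x y p) s 1 s"

inductive_cases SkipE: "exec W Skip s t s'"
inductive_cases AssignE: "exec W (Assign x e) s t s'"
inductive_cases StoreE: "exec W (Store a x y) s t s'"
inductive_cases SeqE: "exec W (Seq p q) s t s'"
inductive_cases IfE: "exec W (IfLess x y p q) s t s'"
inductive_cases WhileE: "exec W (WhileLess x y p) s t s'"

lemma exec_deterministic:
  "exec W p s t s' \<Longrightarrow> exec W p s u s'' \<Longrightarrow> t = u \<and> s' = s''"
proof (induction arbitrary: u s'' rule: exec.induct)
  case (Skip s)
  from Skip.prems show ?case by (rule SkipE) simp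
next
  case (Assign e s x)
  from Assign.prems show ?case by (rule AssignE) simp
next
  case (Store a x y s)
  from Store.prems show ?case by (rule StoreE) simp
next
  case (Seq p s t1 s1 q t2 s2)
  from Seq.prems show ?case
  proof (rule SeqE)
    fix u1 r u2
    assume u: "u = u1 + u2" and p: "exec W p s u1 r" and q: "exec W q r u2 s''"
    have 1: "t1 = u1 \<and> s1 = r" by (rule Seq.IH(1)[OF p])
    have "t2 = u2 \<and> s2 = s''" by (rule Seq.IH(2)) (simp only: 1 q)
    with 1 u show ?thesis by simp
  qed
next
  case (IfTrue s x y p t s' q)
  from IfTrue.prems show ?case
  proof (rule IfE)
    fix u' assume "u = Suc u'" "exec W p s u' s''"
    with IfTrue.IH[of u' s''] show ?thesis by simp
  qed (simp add: IfTrue.hyps)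
next
  case (IfFalse s x y q t s' p)
  from IfFalse.prems show ?case
  proof (rule IfE)
    fix u' assume "u = Suc u'" "exec W q s u' s''"
    with IfFalse.IH[of u' s''] show ?thesis by simp
  qed (simp add: IfFalse.hyps)
next
  case (WhileTrue s x y p t1 s1 t2 s2)
  from WhileTrue.prems show ?case
  proof (rule WhileE)
    fix u1 r u2
    assume u: "u = Suc (u1 + u2)" and p: "exec W p s u1 r"
      and q: "exec W (WhileLess x y p) r u2 s''"
    have 1: "t1 = u1 \<and> s1 = r" by (rule WhileTrue.IH(1)[OF p])
    have "t2 = u2 \<and> s2 = s''" by (rule WhileTrue.IH(2)) (simp only: 1 q)
    with 1 u show ?thesis by simp
  qed (simp add: WhileTrue.hyps)
next
  case (WhileFalse s x y p)
  from WhileFalse.prems show ?case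
    by (rule WhileE) (simp_all add: WhileFalse.hyps)
qed


section \<open>Representation of inputs and outputs\<close>

text \<open>The vertices are \<open>0, \<dots>, n - 1\<close>, and an edge set is given as a list of its edges in arbitrary
  order without repetition, stored in three parallel arrays. All memory that does not hold
  input is initially zero.\<close>

definition lists_edges :: "nat edge list \<Rightarrow> nat edge set \<Rightarrow> bool" where
  "lists_edges es E \<longleftrightarrow> distinct es \<and> set es = E"

definition array_of :: "nat list \<Rightarrow> nat \<Rightarrow> nat" where
  "array_of xs i = (if i < length xs then xs ! i else 0)"

definition input_state :: "nat \<Rightarrow> nat \<Rightarrow> nat edge list \<Rightarrow> state" where
  "input_state n \<sigma> es =
     \<lparr>regs = (\<lambda>_. 0)(''n'' := n, ''sigma'' := \<sigma>, ''m'' := length es),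
      arrs = (\<lambda>_ _. 0)(''src'' := array_of (map (\<lambda>(u, v, k). u) es),
                       ''dst'' := array_of (map (\<lambda>(u, v, k). v) es),
                       ''lab'' := array_of (map (\<lambda>(u, v, k). k) es))\<rparr>"

definition output_edges :: "state \<Rightarrow> nat edge list" where
  "output_edges s =
     map (\<lambda>i. (arrs s ''out_src'' i, arrs s ''out_dst'' i, arrs s ''out_lab'' i))
       [0..<regs s ''out_m'']"

end

theory Submission
  imports Defs "HOL-Library.Product_Lexorder"
begin

text \<open>Let \<open>T\<close> be the set of targets of edges and \<open>S\<^sub>k\<close> the set of sources of edges labelled \<open>k\<close>.
  The edges labelled \<open>k\<close> of a Wheeler graph form a monotone staircase, so the optimum is at most
  \<open>\<Sum>k. (|S\<^sub>k| + |T|) \<le> \<sigma> (max\<^sub>k |S\<^sub>k| + |T|)\<close>.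

  Conversely, choose either one incoming edge for every vertex of \<open>T\<close>, or one outgoing edge
  labelled \<open>k\<close> for every vertex of the largest \<open>S\<^sub>k\<close>, whichever gives more edges. Sending each of
  these vertices \<open>x\<close> to the other end \<open>f x\<close> of its edge is a partial map. The pairs with \<open>x < f x\<close>
  form a forest, which is 2-coloured by a descending loop, those with \<open>f x < x\<close> one that is
  2-coloured by an ascending loop, and the rest are loops of the graph. The largest of these five
  classes keeps a fifth of the edges. It consists of loops, or all its sources are on one side of a
  bipartition and all its targets on the other, and such a graph is Wheeler.\<close>

section \<open>Wheeler graphs\<close>

lemma in_degree_eq_0_iff: "finite E \<Longrightarrow> in_degree E v = 0 \<longleftrightarrow> (\<forall>u k. (u, v, k) \<notin> E)"
proof -
  assume "finite E"
  hence "finite {(u, w, k) \<in> E. w = v}"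
    by (rule rev_finite_subset) auto
  thus ?thesis
    unfolding in_degree_def by auto
qed

text \<open>An injective \<open>key\<close> pulls a linear order back to \<open>V\<close>, so the
  Wheeler conditions become inequalities between keys. Finiteness of \<open>E\<close> lets in-degree
  zero be read as absence of incoming edges, since \<open>card\<close> of an infinite set is
  0.\<close>

lemma wheeler_graph_key:
  fixes key :: "'v \<Rightarrow> 'a::linorder"
  assumes "finite E" "inj_on key V"
    and "\<And>u v. u \<in> V \<Longrightarrow> v \<in> V \<Longrightarrow> \<forall>w k. (w, u, k) \<notin> E \<Longrightarrow> \<exists>w k. (w, v, k) \<in> E \<Longrightarrow> key u < key v"
    and "\<And>u v k u' v' k'. (u, v, k) \<in> E \<Longrightarrow> (u', v', k') \<in> E \<Longrightarrow> k < k' \<Longrightarrow> key v < key v'"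
    and "\<And>u v k u' v'. (u, v, k) \<in> E \<Longrightarrow> (u', v', k) \<in> E \<Longrightarrow> key u < key u' \<Longrightarrow>
      v = v' \<or> key v < key v'"
  shows "wheeler_graph V E"
proof -
  let ?r = "{(x, y). key x < key y}"
  have "strict_linear_order_on V ?r"
    unfolding strict_linear_order_on_def trans_def irrefl_def total_on_def
    using inj_onD[OF assms(2)] by (auto, metis linorder_cases)
  hence "wheeler_order V E ?r"
    unfolding wheeler_order_def neq0_conv[symmetric] in_degree_eq_0_iff[OF assms(1)]
    using assms(3-5) by simp metis
  thus ?thesis
    unfolding wheeler_graph_def ..
qed

text \<open>Vertices without incoming edges come first, the others are ordered by the label and the
  source of their unique incoming edge.\<close>

lemma wheeler_graph_unique_in:
  fixes E :: "'v::linorder edge set"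
  assumes "finite E"
    and uniq: "\<And>u k u' k' v. (u, v, k) \<in> E \<Longrightarrow> (u', v, k') \<in> E \<Longrightarrow> u = u' \<and> k = k'"
    and shape: "(\<forall>u v k. (u, v, k) \<in> E \<longrightarrow> u = v) \<or>
      (\<forall>u v k u' v' k'. (u, v, k) \<in> E \<and> (u', v', k') \<in> E \<longrightarrow> u \<noteq> v')"
  shows "wheeler_graph V E"
proof -
  define e where "e v = (SOME (u, k). (u, v, k) \<in> E)" for v
  have e: "e v = (u, k)" if "(u, v, k) \<in> E" for u v k
  proof -
    have "case e v of (u, k) \<Rightarrow> (u, v, k) \<in> E"
      unfolding e_def using that by (rule_tac someI[of _ "(u, k)"]) simp
    hence "(fst (e v), v, snd (e v)) \<in> E"
      by (simp add: case_prod_beta)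
    from uniq[OF that this] show ?thesis
      by (simp add: prod_eq_iff)
  qed
  \<comment> \<open>Tuples are compared lexicographically: the first component puts in-degree zero
    first, label before source reflects conditions (i) and (ii), and the last one makes the key
    injective.\<close>
  define key where "key v =
    (if \<exists>u k. (u, v, k) \<in> E then (1::nat, snd (e v), fst (e v), v) else (0, 0, v, v))" for v
  have key: "key v = (1, k, u, v)" if "(u, v, k) \<in> E" for u v k
    using that e[OF that] by (auto simp: key_def)
  have key0: "key u = (0, 0, u, u)" if "\<forall>w k. (w, u, k) \<notin> E" for u
    using that by (simp add: key_def)
  show ?thesis
  proof (rule wheeler_graph_key[where key = key])
    show "inj_on key V"
      by (auto simp: inj_on_def key_def split: if_splits)
  next
    fix u v assume "\<forall>w k. (w, u, k) \<notin> E" "\<exists>w k. (w, v, k) \<in> E"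
    thus "key u < key v"
      by (auto simp: key key0)
  next
    fix u v k u' v' k' assume "(u, v, k) \<in> E" "(u', v', k') \<in> E" "k < k'"
    thus "key v < key v'"
      by (simp add: key)
  next
    fix u v k u' v' assume E: "(u, v, k) \<in> E" "(u', v', k) \<in> E" and less: "key u < key u'"
    \<comment> \<open>For loops the hypothesis on keys is already the conclusion. If no source is a
      target, all sources have in-degree zero and are compared by the given order on
      vertices.\<close>
    from shape show "v = v' \<or> key v < key v'"
    proof
      assume "\<forall>u v k. (u, v, k) \<in> E \<longrightarrow> u = v"
      with E less show ?thesis by blast
    next
      assume "\<forall>u v k u' v' k'. (u, v, k) \<in> E \<and> (u', v', k') \<in> E \<longrightarrow> u \<noteq> v'"
      with E have "key u = (0, 0, u, u)" "key u' = (0, 0, u', u')"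
        by (blast intro: key0)+
      with less have "u < u'" by auto
      with E show ?thesis by (simp add: key)
    qed
  qed fact
qed

text \<open>Targets come last, and the sources are ordered by the target of their unique outgoing
  edge.\<close>

lemma wheeler_graph_unique_out:
  fixes E :: "'v::linorder edge set"
  assumes "finite E"
    and uniq: "\<And>u v v'. (u, v, l) \<in> E \<Longrightarrow> (u, v', l) \<in> E \<Longrightarrow> v = v'"
    and label: "\<And>u v k. (u, v, k) \<in> E \<Longrightarrow> k = l"
    and shape: "(\<forall>u v k. (u, v, k) \<in> E \<longrightarrow> u = v) \<or>
      (\<forall>u v k u' v' k'. (u, v, k) \<in> E \<and> (u', v', k') \<in> E \<longrightarrow> u \<noteq> v')"
  shows "wheeler_graph V E"
  using shape
proof
  assume loops: "\<forall>u v k. (u, v, k) \<in> E \<longrightarrow> u = v"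
  show ?thesis
  \<comment> \<open>Loops of a single label give every vertex at most one incoming edge.\<close>
  proof (rule wheeler_graph_unique_in)
    fix u k u' k' v assume "(u, v, k) \<in> E" "(u', v, k') \<in> E"
    with loops label show "u = u' \<and> k = k'" by metis
  qed (use loops \<open>finite E\<close> in blast)+
next
  assume disj: "\<forall>u v k u' v' k'. (u, v, k) \<in> E \<and> (u', v', k') \<in> E \<longrightarrow> u \<noteq> v'"
  define g where "g u = (SOME v. (u, v, l) \<in> E)" for u
  have g: "g u = v" if "(u, v, k) \<in> E" for u v k
  proof -
    have "(u, v, l) \<in> E"
      using that label[OF that] by simp
    thus ?thesis
      unfolding g_def using uniq by (intro some_equality) blast+
  qed
  \<comment> \<open>Class 0 holds isolated vertices, class 1 sources, class 2 targets. With one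
    label only condition (ii) is at stake among the edges, and sorting the sources by their target
    \<open>g v\<close> makes it hold.\<close>
  define key where "key v =
    (if \<exists>u k. (u, v, k) \<in> E then (2::nat, v, v)
     else if \<exists>w k. (v, w, k) \<in> E then (1, g v, v) else (0, v, v))" for v
  have target: "key v = (2, v, v)" if "(u, v, k) \<in> E" for u v k
    using that by (auto simp: key_def)
  have source: "key u = (1, v, u)" if "(u, v, k) \<in> E" for u v k
  proof -
    have "\<nexists>w k. (w, u, k) \<in> E"
      using that disj by blast
    thus ?thesis
      using that g[OF that] by (auto simp: key_def)
  qed
  show ?thesis
  proof (rule wheeler_graph_key[where key = key])
    show "inj_on key V"
      by (auto simp: inj_on_def key_def split: if_splits)
  next
    fix u v assume "\<forall>w k. (w, u, k) \<notin> E" "\<exists>w k. (w, v, k) \<in> E"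
    thus "key u < key v"
      by (auto simp: key_def)
  next
    fix u v k u' v' k' assume "(u, v, k) \<in> E" "(u', v', k') \<in> E" "k < k'"
    thus "key v < key v'"
      using label by blast
  next
    fix u v k u' v' assume "(u, v, k) \<in> E" "(u', v', k) \<in> E" "key u < key u'"
    thus "v = v' \<or> key v < key v'"
      by (auto simp: source target)
  qed fact
qed

section \<open>Upper bound on the optimum\<close>

text \<open>The edges of one label form a monotone staircase. An edge leading to the first target of its
  source is charged to the source, and every other edge is charged to its target.\<close>

lemma wheeler_card_label_le:
  assumes "labeled_graph V \<sigma> E" "wheeler_graph V E"
  shows "card {e \<in> E. snd (snd e) = k} \<le>
    card {u. \<exists>v. (u, v, k) \<in> E} + card {v. \<exists>u. (u, v, k) \<in> E}"
proof -
  from assms(2) obtain r where r: "wheeler_order V E r"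
    unfolding wheeler_graph_def ..
  hence lin: "strict_linear_order_on V r"
    unfolding wheeler_order_def by blast
  have trans: "trans r" and irrefl: "\<And>x. (x, x) \<notin> r"
    and total: "\<And>x y. x \<in> V \<Longrightarrow> y \<in> V \<Longrightarrow> x = y \<or> (x, y) \<in> r \<or> (y, x) \<in> r"
    using lin unfolding strict_linear_order_on_def irrefl_def total_on_def by blast+
  have mono: "v = v' \<or> (v, v') \<in> r" if "(u, v, k) \<in> E" "(u', v', k) \<in> E" "(u, u') \<in> r" for u v u' v'
    using r that unfolding wheeler_order_def by blast
  have V: "u \<in> V" "v \<in> V" if "(u, v, k) \<in> E" for u v
    using assms(1) that unfolding labeled_graph_def by auto
  define A where "A = {e \<in> E. snd (snd e) = k \<and> (\<forall>v. (fst e, v, k) \<in> E \<longrightarrow> (v, fst (snd e)) \<notin> r)}"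
  define B where "B = {e \<in> E. snd (snd e) = k} - A"
  have finV: "finite {u. \<exists>v. (u, v, k) \<in> E}" "finite {v. \<exists>u. (u, v, k) \<in> E}"
    using V assms(1) unfolding labeled_graph_def by (auto intro: finite_subset[of _ V])
  have "inj_on fst A"
  proof (rule inj_onI)
    fix e e' assume e: "e \<in> A" "e' \<in> A" "fst e = fst e'"
    obtain u v v' where uv: "e = (u, v, k)" "e' = (u, v', k)"
      using e by (cases e; cases e') (auto simp: A_def)
    with e have E: "(u, v, k) \<in> E" "(u, v', k) \<in> E" "(v, v') \<notin> r" "(v', v) \<notin> r"
      by (auto simp: A_def)
    with total[of v v'] V uv show "e = e'" by blast
  qed
  hence A: "card A \<le> card {u. \<exists>v. (u, v, k) \<in> E}"
    by (rule card_inj_on_le[OF _ _ finV(1)]) (auto simp: A_def)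
  \<comment> \<open>Since \<open>(u', v, k)\<close> is not in \<open>A\<close>, \<open>u'\<close>
    has a target \<open>w\<close> before \<open>v\<close>; but monotonicity for \<open>u\<close>
    before \<open>u'\<close> puts \<open>w\<close> at or after \<open>v\<close>.\<close>
  have B_unique: False if "(u, v, k) \<in> B" "(u', v, k) \<in> B" "(u, u') \<in> r" for u u' v
  proof -
    from that(2) obtain w where w: "(u', w, k) \<in> E" "(w, v) \<in> r"
      by (auto simp: A_def B_def)
    with mono[of u v u' w] that irrefl trans show False
      unfolding B_def trans_def by blast
  qed
  have "inj_on (\<lambda>e. fst (snd e)) B"
  proof (rule inj_onI)
    fix e e' assume e: "e \<in> B" "e' \<in> B" "fst (snd e) = fst (snd e')"
    obtain u v u' where uv: "e = (u, v, k)" "e' = (u', v, k)"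
      using e by (cases e; cases e') (auto simp: B_def)
    with e have "u \<in> V" "u' \<in> V"
      using V by (auto simp: B_def)
    with total consider "u = u'" | "(u, u') \<in> r" | "(u', u) \<in> r" by blast
    thus "e = e'"
      using B_unique e uv by cases auto
  qed
  hence B: "card B \<le> card {v. \<exists>u. (u, v, k) \<in> E}"
    by (rule card_inj_on_le[OF _ _ finV(2)]) (auto simp: B_def)
  have "{e \<in> E. snd (snd e) = k} = A \<union> B"
    by (auto simp: A_def B_def)
  thus ?thesis
    using A B card_Un_le[of A B] by simp
qed

lemma wheeler_graph_empty: "wheeler_graph V ({} :: 'v::linorder edge set)"
  by (rule wheeler_graph_unique_in) auto

text \<open>A feasible \<open>F\<close> splits by label into \<open>\<sigma>\<close> staircases of
  at most \<open>s + t\<close> edges each. \<open>s\<close> bounds the sources of one label,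
  \<open>t\<close> the targets of all labels at once, matching the two candidate selections.\<close>

lemma ws_opt_le:
  fixes E :: "'v::linorder edge set"
  assumes E: "labeled_graph V \<sigma> E"
    and S: "\<And>k. card {u. \<exists>v. (u, v, k) \<in> E} \<le> s"
    and T: "card {v. \<exists>u k. (u, v, k) \<in> E} \<le> t"
  shows "ws_opt V E \<le> \<sigma> * (s + t)"
proof -
  have finV: "finite V"
    using E unfolding labeled_graph_def by blast
  hence "finite E"
    using E unfolding labeled_graph_def by (meson finite_SigmaI finite_atLeastAtMost finite_subset)
  have E_V: "u \<in> V" "v \<in> V" if "(u, v, k) \<in> E" for u v k
    using E that unfolding labeled_graph_def by auto
  have "card F \<le> \<sigma> * (s + t)" if "ws_feasible V E F" for F
  proof -
    have F: "F \<subseteq> E" "wheeler_graph V F"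
      using that unfolding ws_feasible_def by auto
    hence lab: "labeled_graph V \<sigma> F"
      using E unfolding labeled_graph_def by auto
    have "card {e \<in> F. snd (snd e) = k} \<le> s + t" for k
    proof -
      have "card {u. \<exists>v. (u, v, k) \<in> F} \<le> card {u. \<exists>v. (u, v, k) \<in> E}"
        by (rule card_mono[OF finite_subset[OF _ finV]]) (use F E_V in blast)+
      moreover have "card {v. \<exists>u. (u, v, k) \<in> F} \<le> card {v. \<exists>u k. (u, v, k) \<in> E}"
        by (rule card_mono[OF finite_subset[OF _ finV]]) (use F E_V in blast)+
      ultimately show ?thesis
        using wheeler_card_label_le[OF lab F(2), of k] S[of k] T by linarith
    qed
    moreover have "F = (\<Union>k\<in>{1..\<sigma>}. {e \<in> F. snd (snd e) = k})"
      using lab unfolding labeled_graph_def by fastforce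
    with card_UN_le[of "{1..\<sigma>}" "\<lambda>k. {e \<in> F. snd (snd e) = k}"]
    have "card F \<le> (\<Sum>k\<in>{1..\<sigma>}. card {e \<in> F. snd (snd e) = k})"
      by simp
    ultimately show ?thesis
      using sum_bounded_above[of "{1..\<sigma>}" "\<lambda>k. card {e \<in> F. snd (snd e) = k}" "s + t"] by force
  qed
  moreover have "ws_feasible V E {}"
    unfolding ws_feasible_def by (simp add: wheeler_graph_empty)
  moreover have "finite {F. ws_feasible V E F}"
    by (rule finite_subset[of _ "Pow E"]) (auto simp: ws_feasible_def \<open>finite E\<close>)
  ultimately show ?thesis
    unfolding ws_opt_def by (subst Max_le_iff) auto
qed

section \<open>Reasoning about programs\<close>

primrec sem :: "com \<Rightarrow> state \<Rightarrow> state" where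
  "sem Skip s = s"
| "sem (Assign x e) s = s\<lparr>regs := (regs s)(x := rhs_val e s)\<rparr>"
| "sem (Store a x y) s = s\<lparr>arrs := (arrs s)(a := (arrs s a)(regs s x := regs s y))\<rparr>"
| "sem (Seq p q) s = sem q (sem p s)"
| "sem (IfLess x y p q) s = (if regs s x < regs s y then sem p s else sem q s)"
| "sem (WhileLess x y p) s = s"

text \<open>Loops are never safe, so \<open>sem\<close> and \<open>cost\<close> are only meaningful for loop-free code.\<close>

primrec safe :: "nat \<Rightarrow> com \<Rightarrow> state \<Rightarrow> bool" where
  "safe W Skip s \<longleftrightarrow> True"
| "safe W (Assign x e) s \<longleftrightarrow> rhs_val e s < W"
| "safe W (Store a x y) s \<longleftrightarrow> True"
| "safe W (Seq p q) s \<longleftrightarrow> safe W p s \<and> safe W q (sem p s)"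
| "safe W (IfLess x y p q) s \<longleftrightarrow> (if regs s x < regs s y then safe W p s else safe W q s)"
| "safe W (WhileLess x y p) s \<longleftrightarrow> False"

primrec cost :: "com \<Rightarrow> nat" where
  "cost Skip = 1"
| "cost (Assign x e) = 1"
| "cost (Store a x y) = 1"
| "cost (Seq p q) = cost p + cost q"
| "cost (IfLess x y p q) = 1 + max (cost p) (cost q)"
| "cost (WhileLess x y p) = 0"

primrec written_regs :: "com \<Rightarrow> name set" where
  "written_regs Skip = {}"
| "written_regs (Assign x e) = {x}"
| "written_regs (Store a x y) = {}"
| "written_regs (Seq p q) = written_regs p \<union> written_regs q"
| "written_regs (IfLess x y p q) = written_regs p \<union> written_regs q"
| "written_regs (WhileLess x y p) = written_regs p"

primrec written_arrs :: "com \<Rightarrow> name set" where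
  "written_arrs Skip = {}"
| "written_arrs (Assign x e) = {}"
| "written_arrs (Store a x y) = {a}"
| "written_arrs (Seq p q) = written_arrs p \<union> written_arrs q"
| "written_arrs (IfLess x y p q) = written_arrs p \<union> written_arrs q"
| "written_arrs (WhileLess x y p) = written_arrs p"

text \<open>A frame condition read off the program text: facts on untouched registers and arrays
  cross a loop without entering its invariant.\<close>

definition unchanged :: "com \<Rightarrow> state \<Rightarrow> state \<Rightarrow> bool" where
  "unchanged p s s' \<longleftrightarrow> (\<forall>x. x \<notin> written_regs p \<longrightarrow> regs s' x = regs s x) \<and>
     (\<forall>a. a \<notin> written_arrs p \<longrightarrow> arrs s' a = arrs s a)"

lemma unchanged_exec: "exec W p s t s' \<Longrightarrow> unchanged p s s'"
  by (induction rule: exec.induct) (auto simp: unchanged_def)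

lemma unchanged_sem: "unchanged p s (sem p s)"
  by (induction p arbitrary: s) (auto simp: unchanged_def)

lemma unchanged_reg: "unchanged p s s' \<Longrightarrow> x \<notin> written_regs p \<Longrightarrow> regs s' x = regs s x"
  and unchanged_arr: "unchanged p s s' \<Longrightarrow> a \<notin> written_arrs p \<Longrightarrow> arrs s' a = arrs s a"
  by (auto simp: unchanged_def)

definition fresh :: "name set \<Rightarrow> name set \<Rightarrow> state \<Rightarrow> bool" where
  "fresh R A s \<longleftrightarrow> (\<forall>x\<in>R. regs s x = 0) \<and> (\<forall>a\<in>A. arrs s a = (\<lambda>_. 0))"

lemma fresh_unchanged:
  "unchanged p s t \<Longrightarrow> fresh (R \<union> R') (A \<union> A') s \<Longrightarrow> R \<inter> written_regs p = {} \<Longrightarrow>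
     A \<inter> written_arrs p = {} \<Longrightarrow> fresh R A t"
  by (auto simp: fresh_def unchanged_def)

text \<open>Total correctness with a time bound. The frame condition is built in so that the
  composition rule can hand it to the next program.\<close>

definition runs :: "nat \<Rightarrow> com \<Rightarrow> state \<Rightarrow> nat \<Rightarrow> (state \<Rightarrow> bool) \<Rightarrow> bool" where
  "runs W p s T Q \<longleftrightarrow> (\<exists>t s'. exec W p s t s' \<and> t \<le> T \<and> unchanged p s s' \<and> Q s')"

lemma runs_safe:
  assumes "safe W p s" "Q (sem p s)" "cost p \<le> T"
  shows "runs W p s T Q"
proof -
  have "safe W p s \<Longrightarrow> \<exists>t\<le>cost p. exec W p s t (sem p s)" for s
  proof (induction p arbitrary: s)
    case (Seq p q)
    then obtain t1 t2 where "t1 \<le> cost p" "exec W p s t1 (sem p s)" "t2 \<le> cost q"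
      "exec W q (sem p s) t2 (sem q (sem p s))"
      by (metis safe.simps(4))
    thus ?case
      by (intro exI[of _ "t1 + t2"]) (simp add: exec.Seq)
  next
    case (IfLess x y p q)
    show ?case
    proof (cases "regs s x < regs s y")
      case True
      with IfLess obtain t where "t \<le> cost p" "exec W p s t (sem p s)" by auto
      with True show ?thesis
        using exec.IfTrue[of s x y W p t "sem p s" q] by (intro exI[of _ "1 + t"]) simp
    next
      case False
      with IfLess obtain t where "t \<le> cost q" "exec W q s t (sem q s)" by auto
      with False show ?thesis
        using exec.IfFalse[of s x y W q t "sem q s" p] by (intro exI[of _ "1 + t"]) simp
    qed
  qed (auto intro: exec.intros[unfolded One_nat_def])
  with assms show ?thesis
    unfolding runs_def by (meson order_trans unchanged_sem)
qed

lemma runs_Seq: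
  assumes "runs W p s T P" "\<And>s'. unchanged p s s' \<Longrightarrow> P s' \<Longrightarrow> runs W q s' U Q"
  shows "runs W (Seq p q) s (T + U) Q"
proof -
  from assms(1) obtain t s1 where s1: "exec W p s t s1" "t \<le> T" "unchanged p s s1" "P s1"
    unfolding runs_def by blast
  with assms(2) obtain u s2 where s2: "exec W q s1 u s2" "u \<le> U" "Q s2"
    unfolding runs_def by blast
  have "exec W (Seq p q) s (t + u) s2"
    using s1 s2 by (blast intro: exec.Seq)
  with s1 s2 show ?thesis
    unfolding runs_def by (meson add_mono unchanged_exec)
qed

lemma runs_IfLess:
  assumes "regs s x < regs s y \<Longrightarrow> runs W p s T Q" "\<not> regs s x < regs s y \<Longrightarrow> runs W q s T Q"
  shows "runs W (IfLess x y p q) s (1 + T) Q"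
proof (cases "regs s x < regs s y")
  case True
  with assms(1) obtain t s' where s': "exec W p s t s'" "t \<le> T" "Q s'"
    unfolding runs_def by blast
  hence "exec W (IfLess x y p q) s (1 + t) s'"
    using True by (blast intro: exec.IfTrue)
  with s' show ?thesis
    unfolding runs_def by (meson add_left_mono unchanged_exec)
next
  case False
  with assms(2) obtain t s' where s': "exec W q s t s'" "t \<le> T" "Q s'"
    unfolding runs_def by blast
  hence "exec W (IfLess x y p q) s (1 + t) s'"
    using False by (blast intro: exec.IfFalse)
  with s' show ?thesis
    unfolding runs_def by (meson add_left_mono unchanged_exec)
qed

lemma runs_weaken: "runs W p s T P \<Longrightarrow> T \<le> U \<Longrightarrow> (\<And>s'. unchanged p s s' \<Longrightarrow> P s' \<Longrightarrow> Q s') \<Longrightarrow> runs W p s U Q"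
  unfolding runs_def by (meson order_trans)

text \<open>\<open>\<mu>\<close> bounds the number of remaining rounds. A round costs one test plus
  at most \<open>cost p\<close>, and the final failing test gives the summand 1. The body must be
  \<open>safe\<close>, hence loop-free.\<close>

lemma runs_WhileLess:
  assumes "I s"
    and step: "\<And>s'. unchanged p s s' \<Longrightarrow> I s' \<Longrightarrow> regs s' x < regs s' y \<Longrightarrow>
      safe W p s' \<and> I (sem p s') \<and> \<mu> (sem p s') < \<mu> s'"
  shows "runs W (WhileLess x y p) s (Suc (cost p) * \<mu> s + 1) (\<lambda>s'. I s' \<and> \<not> regs s' x < regs s' y)"
proof -
  have "\<exists>t s''. exec W (WhileLess x y p) s' t s'' \<and> t \<le> Suc (cost p) * \<mu> s' + 1 \<and> I s'' \<and>
    \<not> regs s'' x < regs s'' y" if "unchanged p s s'" "I s'" for s'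
    using that
  proof (induction "\<mu> s'" arbitrary: s' rule: less_induct)
    case less
    show ?case
    proof (cases "regs s' x < regs s' y")
      case True
      with step less have *: "safe W p s'" "I (sem p s')" "\<mu> (sem p s') < \<mu> s'" by auto
      have "unchanged p s (sem p s')"
        using less.prems(1) unchanged_sem[of p s'] by (auto simp: unchanged_def)
      with less.hyps * obtain t s'' where s'': "exec W (WhileLess x y p) (sem p s') t s''"
        "t \<le> Suc (cost p) * \<mu> (sem p s') + 1" "I s''" "\<not> regs s'' x < regs s'' y"
        by blast
      from runs_safe[OF *(1), of "\<lambda>s''. s'' = sem p s'" "cost p"]
      obtain u where u: "exec W p s' u (sem p s')" "u \<le> cost p"
        unfolding runs_def by blast
      have "exec W (WhileLess x y p) s' (1 + u + t) s''"
        using True u(1) s''(1) by (rule exec.WhileTrue)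
      \<comment> \<open>The strict decrease of \<open>\<mu>\<close> frees one share
        \<open>Suc (cost p)\<close>, which pays for this round.\<close>
      moreover have "Suc (cost p) * Suc (\<mu> (sem p s')) \<le> Suc (cost p) * \<mu> s'"
        using *(3) by (intro mult_le_mono) auto
      hence "1 + u + t \<le> Suc (cost p) * \<mu> s' + 1"
        using s''(2) u(2) by simp
      ultimately show ?thesis
        using s''(3,4) by blast
    next
      case False
      with less.prems show ?thesis
        by (intro exI[of _ 1] exI[of _ s']) (simp add: exec.WhileFalse[unfolded One_nat_def])
    qed
  qed
  moreover have "unchanged p s s"
    by (simp add: unchanged_def)
  ultimately show ?thesis
    using assms(1) unfolding runs_def by (meson unchanged_exec)
qed

notation Seq (infixr ";;" 60)
notation Assign (infix "::=" 61)

lemma runs_Assign_Seq: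
  assumes "rhs_val e s < W" "runs W q (s\<lparr>regs := (regs s)(x := rhs_val e s)\<rparr>) T Q"
  shows "runs W (x ::= e ;; q) s (1 + T) Q"
  using assms(1) by (intro runs_Seq[OF runs_safe[where Q = "\<lambda>t. t = s\<lparr>regs := (regs s)(x := rhs_val e s)\<rparr>"]])
    (simp_all add: assms(2))

section \<open>The algorithm\<close>

text \<open>Edges are referred to by their index in the input increased by one, and 0 stands for no edge.
  The edges with source \<open>u\<close> form a linked list with first element \<open>head u\<close> and successor function
  \<open>nxt\<close>. While the list of \<open>u\<close> is traversed, \<open>stamp k = u + 1\<close> records that a label \<open>k\<close> has
  already been counted for \<open>u\<close>, so that \<open>cnt k\<close> ends as the number of sources of edges labelled
  \<open>k\<close>. The chosen edge of a vertex \<open>x\<close> is \<open>sel x\<close>, and \<open>cls x\<close> is its class.\<close>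

definition init :: com where
  "init = ''one'' ::= Const 1 ;; ''two'' ::= Const 2 ;; ''three'' ::= Const 3 ;;
     ''four'' ::= Const 4 ;; ''five'' ::= Const 5"

text \<open>\<open>i\<close> is incremented before the stores, so the stored value is the index plus
  one. \<open>inn v\<close> is nonzero once \<open>v\<close> has been a target, hence
  \<open>tcnt\<close> counts distinct targets.\<close>

definition link_body :: com where
  "link_body =
     ''u'' ::= Load ''src'' ''i'' ;; ''v'' ::= Load ''dst'' ''i'' ;;
     ''h'' ::= Load ''head'' ''u'' ;; ''e'' ::= Load ''inn'' ''v'' ;;
     ''i'' ::= Add ''i'' ''one'' ;;
     Store ''nxt'' ''i'' ''h'' ;; Store ''head'' ''u'' ''i'' ;; Store ''inn'' ''v'' ''i'' ;;
     IfLess ''z'' ''e'' Skip (''tcnt'' ::= Add ''tcnt'' ''one'')"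

text \<open>A round either takes one edge from the list of \<open>u\<close> or moves on to the next
  vertex, which turns the nested traversal into one loop of at most \<open>n + m\<close> rounds. As
  \<open>u\<close> only grows, older stamps stay below \<open>u + 1\<close> and need no
  clearing.\<close>

definition count_body :: com where
  "count_body =
     IfLess ''z'' ''p''
       (''q'' ::= Sub ''p'' ''one'' ;; ''k'' ::= Load ''lab'' ''q'' ;;
        ''w'' ::= Add ''u'' ''one'' ;; ''e'' ::= Load ''stamp'' ''k'' ;;
        ''p'' ::= Load ''nxt'' ''p'' ;;
        IfLess ''e'' ''w''
          (Store ''stamp'' ''k'' ''w'' ;;
           ''c'' ::= Load ''cnt'' ''k'' ;; ''c'' ::= Add ''c'' ''one'' ;; Store ''cnt'' ''k'' ''c'' ;;
           IfLess ''best'' ''c'' (''best'' ::= Reg ''c'' ;; ''bk'' ::= Reg ''k'') Skip)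
          Skip)
       (''u'' ::= Add ''u'' ''one'' ;; ''p'' ::= Load ''head'' ''u'')"

definition pick_in_body :: com where
  "pick_in_body =
     ''u'' ::= Load ''src'' ''i'' ;; ''v'' ::= Load ''dst'' ''i'' ;;
     ''i'' ::= Add ''i'' ''one'' ;;
     Store ''sel'' ''v'' ''i'' ;; Store ''f'' ''v'' ''u''"

definition pick_out_body :: com where
  "pick_out_body =
     ''u'' ::= Load ''src'' ''i'' ;; ''v'' ::= Load ''dst'' ''i'' ;; ''k'' ::= Load ''lab'' ''i'' ;;
     ''i'' ::= Add ''i'' ''one'' ;;
     IfLess ''k'' ''bk'' Skip
       (IfLess ''bk'' ''k'' Skip (Store ''sel'' ''u'' ''i'' ;; Store ''f'' ''u'' ''v''))"

text \<open>\<open>x\<close> descends, so the colour of a larger \<open>f x\<close> is already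
  final. A root has class 0 here and sends its predecessors to class 2.\<close>

definition forward_body :: com where
  "forward_body =
     ''x'' ::= Sub ''x'' ''one'' ;; ''e'' ::= Load ''sel'' ''x'' ;;
     IfLess ''z'' ''e''
       (''y'' ::= Load ''f'' ''x'' ;;
        IfLess ''x'' ''y''
          (''c'' ::= Load ''cls'' ''y'' ;;
           IfLess ''c'' ''two'' (Store ''cls'' ''x'' ''two'') (Store ''cls'' ''x'' ''one''))
          Skip)
       Skip"

text \<open>\<open>x\<close> ascends, so a smaller \<open>f x\<close> already has its final class: 0
  to 3 lead to class 4, the others to class 3. Class sizes are tallied in the same pass.\<close>

definition backward_body :: com where
  "backward_body =
     ''e'' ::= Load ''sel'' ''x'' ;;
     IfLess ''z'' ''e''
       (''y'' ::= Load ''f'' ''x'' ;;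
        IfLess ''y'' ''x''
          (''c'' ::= Load ''cls'' ''y'' ;;
           IfLess ''c'' ''four'' (Store ''cls'' ''x'' ''four'') (Store ''cls'' ''x'' ''three''))
          (IfLess ''x'' ''y'' Skip (Store ''cls'' ''x'' ''five'')) ;;
        ''c'' ::= Load ''cls'' ''x'' ;; ''d'' ::= Load ''ccnt'' ''c'' ;;
        ''d'' ::= Add ''d'' ''one'' ;; Store ''ccnt'' ''c'' ''d'' ;;
        IfLess ''bestc'' ''d'' (''bestc'' ::= Reg ''d'' ;; ''b'' ::= Reg ''c'') Skip)
       Skip ;;
     ''x'' ::= Add ''x'' ''one''"

definition output_body :: com where
  "output_body =
     ''e'' ::= Load ''sel'' ''x'' ;;
     IfLess ''z'' ''e''
       (''c'' ::= Load ''cls'' ''x'' ;;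
        IfLess ''c'' ''b'' Skip (IfLess ''b'' ''c'' Skip
          (''e'' ::= Sub ''e'' ''one'' ;;
           ''u'' ::= Load ''src'' ''e'' ;; Store ''out_src'' ''out_m'' ''u'' ;;
           ''u'' ::= Load ''dst'' ''e'' ;; Store ''out_dst'' ''out_m'' ''u'' ;;
           ''u'' ::= Load ''lab'' ''e'' ;; Store ''out_lab'' ''out_m'' ''u'' ;;
           ''out_m'' ::= Add ''out_m'' ''one'')))
       Skip ;;
     ''x'' ::= Add ''x'' ''one''"

lemmas body_defs = link_body_def count_body_def pick_in_body_def pick_out_body_def
  forward_body_def backward_body_def output_body_def init_def

definition select_com :: com where
  "select_com = WhileLess ''i'' ''m'' link_body ;;
     ''u'' ::= Reg ''z'' ;; ''p'' ::= Load ''head'' ''u'' ;; WhileLess ''u'' ''n'' count_body ;;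
     ''i'' ::= Reg ''z'' ;;
     IfLess ''best'' ''tcnt'' (WhileLess ''i'' ''m'' pick_in_body) (WhileLess ''i'' ''m'' pick_out_body)"

definition colour_com :: com where
  "colour_com = ''x'' ::= Reg ''n'' ;; WhileLess ''z'' ''x'' forward_body ;;
     ''x'' ::= Reg ''z'' ;; WhileLess ''x'' ''n'' backward_body ;;
     ''x'' ::= Reg ''z'' ;; WhileLess ''x'' ''n'' output_body"

definition wheeler_com :: com where
  "wheeler_com = init ;; select_com ;; colour_com"

section \<open>Correctness\<close>

text \<open>Every computed word is a vertex, label, edge index or count, up to a small additive
  constant, so \<open>words\<close> keeps the run from getting stuck.\<close>

locale ws_input =
  fixes n \<sigma> :: nat and es :: "nat edge list" and W :: nat
  assumes distinct: "distinct es"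
    and edges: "set es \<subseteq> {..<n} \<times> {..<n} \<times> {1..\<sigma>}"
    and words: "n + \<sigma> + length es + 10 < W"
begin

abbreviation m :: nat where "m \<equiv> length es"
definition source :: "nat \<Rightarrow> nat" where "source j = fst (es ! j)"
definition target :: "nat \<Rightarrow> nat" where "target j = fst (snd (es ! j))"
definition label :: "nat \<Rightarrow> nat" where "label j = snd (snd (es ! j))"

lemma edge_bounds: "j < m \<Longrightarrow> source j < n" "j < m \<Longrightarrow> target j < n" "j < m \<Longrightarrow> label j \<le> \<sigma>"
  using edges nth_mem[of j es] unfolding source_def target_def label_def by (cases "es ! j"; auto)+

definition base :: "state \<Rightarrow> bool" where
  "base s \<longleftrightarrow> regs s ''n'' = n \<and> regs s ''m'' = m \<and> regs s ''z'' = 0 \<and> regs s ''one'' = 1 \<and>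
     regs s ''two'' = 2 \<and> regs s ''three'' = 3 \<and> regs s ''four'' = 4 \<and> regs s ''five'' = 5 \<and>
     (\<forall>j<m. arrs s ''src'' j = source j \<and> arrs s ''dst'' j = target j \<and> arrs s ''lab'' j = label j)"

definition keeps_base :: "com \<Rightarrow> bool" where
  "keeps_base p \<longleftrightarrow>
     written_regs p \<inter> {''n'', ''m'', ''z'', ''one'', ''two'', ''three'', ''four'', ''five''} = {} \<and>
     written_arrs p \<inter> {''src'', ''dst'', ''lab''} = {}"

lemma base_unchanged: "unchanged p s s' \<Longrightarrow> base s \<Longrightarrow> keeps_base p \<Longrightarrow> base s'"
  unfolding unchanged_def base_def keeps_base_def by auto

text \<open>The input arrays and constant registers survive for syntactic reasons, so the invariants
  \<open>I\<close> need not mention them.\<close>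

lemma runs_loop:
  fixes I :: "state \<Rightarrow> bool"
  assumes "base s" "keeps_base p" "I s"
    and step: "\<And>t. base t \<Longrightarrow> unchanged p s t \<Longrightarrow> I t \<Longrightarrow> regs t x < regs t y \<Longrightarrow>
      safe W p t \<and> I (sem p t) \<and> \<mu> (sem p t) < \<mu> t"
    and cost: "Suc (cost p) * \<mu> s + 1 \<le> T"
    and exit: "\<And>t. base t \<Longrightarrow> unchanged p s t \<Longrightarrow> I t \<Longrightarrow> \<not> regs t x < regs t y \<Longrightarrow> Q t"
  shows "runs W (WhileLess x y p) s T (\<lambda>t. base t \<and> Q t)"
proof -
  have base: "base t" if "unchanged p s t" for t
    using base_unchanged that assms by blast
  show ?thesis
    by (rule runs_weaken[OF runs_WhileLess[of I s p x y W \<mu>] cost])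
      (use base assms(3) step exit in \<open>auto simp: unchanged_def\<close>)
qed

section \<open>Adjacency lists and the numbers of sources and targets\<close>

primrec previous :: "nat \<Rightarrow> nat \<Rightarrow> nat" where
  "previous u 0 = 0"
| "previous u (Suc j) = (if source j = u then Suc j else previous u j)"

lemma previous_le: "previous u j \<le> j"
  by (induction j) auto

lemma source_previous: "0 < previous u j \<Longrightarrow> source (previous u j - 1) = u"
  by (induction j) auto

lemma previous_gap: "i < j \<Longrightarrow> previous u j \<le> i \<Longrightarrow> source i \<noteq> u"
  by (induction j) (auto simp: less_Suc_eq split: if_splits)

text \<open>\<open>previous u j\<close> is one more than the last index below \<open>j\<close> of an
  edge from \<open>u\<close>, or 0. It is the head of the list of \<open>u\<close> after
  \<open>j\<close> edges, and thus the old head stored as successor when edge \<open>j\<close>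
  starts at \<open>u\<close>.\<close>

definition linked :: "state \<Rightarrow> bool" where
  "linked s \<longleftrightarrow> (\<forall>u. arrs s ''head'' u = previous u m) \<and>
     (\<forall>j<m. arrs s ''nxt'' (Suc j) = previous (source j) j)"

lemma runs_link:
  assumes "base s" "regs s ''i'' = 0" "arrs s ''head'' = (\<lambda>_. 0)" "arrs s ''inn'' = (\<lambda>_. 0)"
    "regs s ''tcnt'' = 0"
  shows "runs W (WhileLess ''i'' ''m'' link_body) s (11 * m + 1)
    (\<lambda>s. base s \<and> linked s \<and> regs s ''tcnt'' = card (target ` {..<m}))"
proof -
  \<comment> \<open>The bound on \<open>inn\<close> by \<open>W\<close> is carried along because
    loading from \<open>inn\<close> must not get stuck.\<close>
  define I :: "state \<Rightarrow> bool" where "I s \<longleftrightarrow>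
    regs s ''i'' \<le> m \<and> (\<forall>u. arrs s ''head'' u = previous u (regs s ''i'')) \<and>
    (\<forall>j<regs s ''i''. arrs s ''nxt'' (Suc j) = previous (source j) j) \<and>
    (\<forall>v. arrs s ''inn'' v < W \<and> (0 < arrs s ''inn'' v \<longleftrightarrow> v \<in> target ` {..<regs s ''i''})) \<and>
    regs s ''tcnt'' = card (target ` {..<regs s ''i''})" for s
  show ?thesis
  proof (rule runs_loop[where I = I and \<mu> = "\<lambda>s. m - regs s ''i''"])
    fix t assume base: "base t" and I: "I t" and less: "regs t ''i'' < regs t ''m''"
    obtain i where i: "regs t ''i'' = i" by blast
    have "i < m"
      using base less i by (simp add: base_def)
    hence *: "arrs t ''src'' i = source i" "arrs t ''dst'' i = target i" "regs t ''one'' = 1"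
      "regs t ''z'' = 0" "source i < W" "target i < W" "regs t ''m'' = m" "Suc i < W"
      using base edge_bounds[of i] words by (auto simp: base_def)
    have card: "card (target ` {..<i}) \<le> i"
      using card_image_le[of "{..<i}" target] by simp
    have prev: "previous u i < W" for u
      using previous_le[of u i] \<open>i < m\<close> words by linarith
    show "safe W link_body t \<and> I (sem link_body t) \<and>
      m - regs (sem link_body t) ''i'' < m - regs t ''i''"
    proof (intro conjI)
      show "safe W link_body t"
        using I * i card prev \<open>i < m\<close> words by (simp add: body_defs I_def)
      show "m - regs (sem link_body t) ''i'' < m - regs t ''i''"
        using i * \<open>i < m\<close> by (auto simp: body_defs)
      show "I (sem link_body t)"
        using I * i \<open>i < m\<close> by (auto simp: body_defs I_def less_Suc_eq lessThan_Suc card_insert_if)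
    qed
  qed (use assms words in \<open>auto simp: I_def linked_def base_def keeps_base_def body_defs\<close>)
qed

text \<open>Lists run from later to earlier edges and \<open>p\<close> is one more than the index of
  the next edge, so the edges of \<open>u\<close> already handled are those with index at least
  \<open>p\<close>.\<close>

definition visited :: "nat \<Rightarrow> nat \<Rightarrow> nat set" where
  "visited u p = {j. j < m \<and> (source j < u \<or> source j = u \<and> p \<le> j)}"

definition sources :: "nat set \<Rightarrow> nat \<Rightarrow> nat set" where
  "sources V k = source ` {j \<in> V. label j = k}"

lemma sources_insert:
  "sources (insert j V) k = (if k = label j then insert (source j) (sources V k) else sources V k)"
  by (auto simp: sources_def)

text \<open>No edge from \<open>u\<close> has an index from \<open>previous u j\<close> up to
  \<open>j - 1\<close>, so lowering the pointer uncovers edge \<open>j\<close> only.\<close>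

lemma visited_step: "j < m \<Longrightarrow> source j = u \<Longrightarrow> visited u (previous u j) = insert j (visited u (Suc j))"
  using previous_gap[of _ j u] previous_le[of u j] by (auto simp: visited_def not_less_eq_eq)
    (metis Suc_leI linorder_neqE_nat)

text \<open>The pointer for \<open>Suc u\<close> starts one above its last edge, so none of its
  edges counts as handled yet.\<close>

lemma visited_next: "visited (Suc u) (previous (Suc u) m) = visited u 0"
  using previous_gap[of _ m "Suc u"] by (auto simp: visited_def less_Suc_eq)

lemma runs_count:
  assumes "base s" "linked s" "regs s ''u'' = 0" "regs s ''p'' = previous 0 m"
    "regs s ''best'' = 0" "regs s ''bk'' = 0" "arrs s ''cnt'' = (\<lambda>_. 0)" "arrs s ''stamp'' = (\<lambda>_. 0)"
  shows "runs W (WhileLess ''u'' ''n'' count_body) s (20 * (n + m) + 1)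
    (\<lambda>s. base s \<and> regs s ''best'' = card (sources {..<m} (regs s ''bk'')) \<and>
      (\<forall>k. card (sources {..<m} k) \<le> regs s ''best''))"
proof -
  define I :: "state \<Rightarrow> bool" where "I s \<longleftrightarrow> (let u = regs s ''u''; p = regs s ''p'' in
    u \<le> n \<and> p \<le> m \<and> (0 < p \<longrightarrow> source (p - 1) = u) \<and>
    (\<forall>k. arrs s ''cnt'' k = card (sources (visited u p) k) \<and>
      arrs s ''stamp'' k \<le> Suc u \<and>
      (arrs s ''stamp'' k = Suc u \<longleftrightarrow> u \<in> sources (visited u p) k) \<and>
      arrs s ''cnt'' k \<le> regs s ''best'') \<and>
    regs s ''best'' = arrs s ''cnt'' (regs s ''bk''))" for s
  \<comment> \<open>Each round increases \<open>u\<close> or visits one new edge.\<close>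
  define \<mu> where "\<mu> s = (n - regs s ''u'') + (m - card (visited (regs s ''u'') (regs s ''p'')))"
    for s :: state
  have fin: "finite (visited u p)" for u p
    by (simp add: visited_def)
  have card_visited: "card (visited u p) \<le> m" for u p
    using card_mono[of "{..<m}" "visited u p"] by (auto simp: visited_def)
  show ?thesis
  proof (rule runs_loop[where I = I and \<mu> = \<mu>])
    fix t assume base: "base t" and "unchanged count_body s t" and I: "I t"
      and less: "regs t ''u'' < regs t ''n''"
    have linked: "linked t"
      using assms(2) \<open>unchanged count_body s t\<close>
      by (auto simp: linked_def unchanged_def body_defs)
    obtain u p where up: "regs t ''u'' = u" "regs t ''p'' = p" by blast
    have u: "u < n" "Suc u < W"
      using base less up words by (auto simp: base_def)
    have p: "p \<le> m" "0 < p \<longrightarrow> source (p - 1) = u"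
      using I up by (auto simp: I_def)
    have prev: "previous v j < W" if "j \<le> m" for v j
      using previous_le[of v j] that words by linarith
    have reg: "regs t ''z'' = 0" "regs t ''one'' = 1"
      using base by (auto simp: base_def)
    show "safe W count_body t \<and> I (sem count_body t) \<and> \<mu> (sem count_body t) < \<mu> t"
    proof (cases p)
      case 0
      have *: "arrs t ''head'' (Suc u) = previous (Suc u) m"
        using linked by (simp add: linked_def)
      have "Suc u \<notin> sources (visited u 0) k" for k
        by (auto simp: visited_def sources_def)
      moreover have "previous (Suc u) m \<le> m" "0 < previous (Suc u) m \<Longrightarrow> source (previous (Suc u) m - 1) = Suc u"
        by (rule previous_le source_previous)+
      moreover have "arrs t ''cnt'' k = card (sources (visited u 0) k)"
        "arrs t ''stamp'' k < Suc (Suc u)" "arrs t ''cnt'' k \<le> regs t ''best''"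
        "regs t ''best'' = arrs t ''cnt'' (regs t ''bk'')" for k
        using I unfolding I_def Let_def up 0 less_Suc_eq_le by blast+
      ultimately have "I (sem count_body t)"
        using * u up 0 reg
        by (simp add: body_defs I_def Let_def visited_next less_imp_le less_imp_neq)
      moreover have "safe W count_body t"
        using * u up 0 reg prev by (simp add: body_defs)
      moreover have "\<mu> (sem count_body t) < \<mu> t"
        using * u up 0 reg by (simp add: body_defs \<mu>_def visited_next)
      ultimately show ?thesis by blast
    next
      case (Suc j)
      hence j: "j < m" "source j = u"
        using p by auto
      define k where "k = label j"
      define V where "V = visited u (Suc j)"
      have *: "arrs t ''lab'' j = k" "arrs t ''nxt'' (Suc j) = previous u j"
        using base linked j by (auto simp: linked_def base_def k_def)
      have k: "k < W"
        using edge_bounds(3)[OF j(1)] words by (simp add: k_def)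
      have V: "visited u (previous u j) = insert j V"
        by (simp add: V_def visited_step[OF j])
      moreover have "j \<notin> V"
        using j by (simp add: V_def visited_def)
      ultimately have "card V < card (visited u (previous u j))"
        using fin[of u "Suc j"] by (simp add: V_def)
      hence less: "m - card (visited u (previous u j)) < m - card V"
        using card_visited[of u "previous u j"] by linarith
      have new: "sources (insert j V) k' = (if k' = k then insert u (sources V k') else sources V k')" for k'
        using j by (simp add: k_def sources_insert)
      have I': "arrs t ''cnt'' k' = card (sources V k')"
        "arrs t ''stamp'' k' \<le> Suc u"
        "arrs t ''stamp'' k' = Suc u \<longleftrightarrow> u \<in> sources V k'"
        "arrs t ''cnt'' k' \<le> regs t ''best''"
        "regs t ''best'' = arrs t ''cnt'' (regs t ''bk'')" for k'
        using I unfolding I_def Let_def up Suc V_def by blast+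
      have fin': "finite (sources V k')" for k'
        using fin by (simp add: V_def sources_def)
      have cnt: "arrs t ''cnt'' k \<le> m"
        unfolding I'(1) using card_image_le[of "{i \<in> V. label i = k}" source]
          card_mono[of V "{i \<in> V. label i = k}"] card_visited[of u "Suc j"] fin
        by (auto simp: V_def sources_def)
      have prev': "previous u j \<le> m" "0 < previous u j \<Longrightarrow> source (previous u j - 1) = u"
        using previous_le[of u j] source_previous[of u j] j by auto
      have "safe W count_body t"
        using * I'(2)[of k] cnt u k up Suc reg prev[of j u] j words by (simp add: body_defs)
      moreover have "\<mu> (sem count_body t) < \<mu> t"
        using * u up Suc reg less by (simp add: body_defs \<mu>_def V_def)
      moreover have "I (sem count_body t)"
      \<comment> \<open>A stamp below \<open>Suc u\<close> means that \<open>u\<close> is a new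
        source for \<open>k\<close>; otherwise the edge changes no set of sources.\<close>
      proof (cases "arrs t ''stamp'' k < Suc u")
        case True
        hence "u \<notin> sources V k"
          using I'(3)[of k] by simp
        hence "card (insert u (sources V k)) = Suc (arrs t ''cnt'' k)"
          using I'(1)[of k] fin' by simp
        moreover have "arrs t ''cnt'' k' \<le> Suc (arrs t ''cnt'' k)" if "regs t ''best'' \<le> Suc (arrs t ''cnt'' k)" for k'
          using I'(4)[of k'] that by simp
        ultimately show ?thesis
          using True I' * u up Suc reg prev' V
          by (auto simp: body_defs I_def Let_def new)
      next
        case False
        hence "u \<in> sources V k"
          using I'(2,3)[of k] by simp
        hence "sources (insert j V) k' = sources V k'" for k'
          by (auto simp: new)
        thus ?thesis
          using False I' * u up Suc reg prev' V
          by (auto simp: body_defs I_def Let_def)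
      qed
      ultimately show ?thesis by blast
    qed
  next
    fix t assume "base t" and I: "I t" and "\<not> regs t ''u'' < regs t ''n''"
    hence u: "regs t ''u'' = n"
      by (auto simp: base_def I_def Let_def)
    \<comment> \<open>All sources lie below \<open>n\<close>, so at \<open>u = n\<close> every edge
      is visited, whatever \<open>p\<close> is.\<close>
    have "visited n p = {..<m}" for p
      using edge_bounds(1) by (auto simp: visited_def)
    moreover have "arrs t ''cnt'' k = card (sources (visited n (regs t ''p'')) k)"
      "arrs t ''cnt'' k \<le> regs t ''best''" "regs t ''best'' = arrs t ''cnt'' (regs t ''bk'')" for k
      using I unfolding I_def Let_def u by blast+
    ultimately show "regs t ''best'' = card (sources {..<m} (regs t ''bk'')) \<and>
        (\<forall>k. card (sources {..<m} k) \<le> regs t ''best'')"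
      by metis
  next
    have "visited 0 (previous 0 m) = {}"
      using previous_gap[of _ m 0] by (fastforce simp: visited_def)
    thus "I s"
      using assms previous_le[of 0 m] source_previous[of 0 m] by (simp add: I_def Let_def sources_def)
  next
    show "Suc (cost count_body) * \<mu> s + 1 \<le> 20 * (n + m) + 1"
    proof -
      have "Suc (cost count_body) \<le> 20"
        by (simp add: body_defs)
      moreover have "\<mu> s \<le> n + m"
        by (simp add: \<mu>_def)
      ultimately show ?thesis
        by (simp only: add_le_cancel_right mult_le_mono)
    qed
  qed (use assms in \<open>auto simp: keeps_base_def body_defs\<close>)
qed

section \<open>One chosen edge per target, or per source of one label\<close>

definition chosen :: "state \<Rightarrow> nat \<Rightarrow> (nat \<Rightarrow> nat) \<Rightarrow> (nat \<Rightarrow> nat) \<Rightarrow> (nat \<Rightarrow> bool) \<Rightarrow> bool" where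
  "chosen s i a b P \<longleftrightarrow> (\<forall>x. arrs s ''sel'' x \<le> i \<and>
     (0 < arrs s ''sel'' x \<longleftrightarrow> x \<in> a ` {j. j < i \<and> P j}) \<and>
     (0 < arrs s ''sel'' x \<longrightarrow> (let j = arrs s ''sel'' x - 1 in a j = x \<and> b j = arrs s ''f'' x \<and> P j)))"

lemma image_less_Suc:
  "x \<in> a ` {j. j < Suc i \<and> P j} \<longleftrightarrow> (x = a i \<and> P i) \<or> x \<in> a ` {j. j < i \<and> P j}"
  by (auto simp: less_Suc_eq)

text \<open>In \<open>chosen\<close>, \<open>a\<close> gives the indexing end, \<open>b\<close> the
  other end and \<open>P\<close> the admissible edges, so one predicate serves both modes. Later
  edges may overwrite earlier choices, since any admissible edge will do.\<close>

lemma runs_pick_in: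
  assumes "base s" "regs s ''i'' = 0" "arrs s ''sel'' = (\<lambda>_. 0)"
  shows "runs W (WhileLess ''i'' ''m'' pick_in_body) s (9 * m + 1)
    (\<lambda>s. base s \<and> chosen s m target source (\<lambda>_. True))"
proof -
  define I :: "state \<Rightarrow> bool" where "I s \<longleftrightarrow>
    regs s ''i'' \<le> m \<and> chosen s (regs s ''i'') target source (\<lambda>_. True)" for s
  show ?thesis
  proof (rule runs_loop[where I = I and \<mu> = "\<lambda>s. m - regs s ''i''"])
    fix t assume base: "base t" and I: "I t" and less: "regs t ''i'' < regs t ''m''"
    obtain i where i: "regs t ''i'' = i" by blast
    have "i < m"
      using base less i by (simp add: base_def)
    hence *: "arrs t ''src'' i = source i" "arrs t ''dst'' i = target i" "regs t ''one'' = 1"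
      "source i < W" "target i < W" "Suc i < W"
      using base edge_bounds[of i] words by (auto simp: base_def)
    show "safe W pick_in_body t \<and> I (sem pick_in_body t) \<and>
      m - regs (sem pick_in_body t) ''i'' < m - regs t ''i''"
      using I * i \<open>i < m\<close>
      by (auto simp: body_defs I_def chosen_def image_less_Suc[where P = "\<lambda>_. True", simplified] Let_def le_SucI)
  qed (use assms in \<open>auto simp: I_def base_def chosen_def keeps_base_def body_defs\<close>)
qed

lemma runs_pick_out:
  assumes "base s" "regs s ''i'' = 0" "arrs s ''sel'' = (\<lambda>_. 0)"
  shows "runs W (WhileLess ''i'' ''m'' pick_out_body) s (9 * m + 1)
    (\<lambda>t. base t \<and> chosen t m source target (\<lambda>j. label j = regs s ''bk''))"
proof -
  let ?P = "\<lambda>j. label j = regs s ''bk''"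
  define I :: "state \<Rightarrow> bool" where "I t \<longleftrightarrow>
    regs t ''i'' \<le> m \<and> chosen t (regs t ''i'') source target ?P" for t
  show ?thesis
  proof (rule runs_loop[where I = I and \<mu> = "\<lambda>s. m - regs s ''i''"])
    fix t assume base: "base t" and "unchanged pick_out_body s t" and I: "I t"
      and less: "regs t ''i'' < regs t ''m''"
    have bk: "regs t ''bk'' = regs s ''bk''"
      using \<open>unchanged pick_out_body s t\<close> by (rule unchanged_reg) (simp add: body_defs)
    obtain i where i: "regs t ''i'' = i" by blast
    have "i < m"
      using base less i by (simp add: base_def)
    hence *: "arrs t ''src'' i = source i" "arrs t ''dst'' i = target i" "arrs t ''lab'' i = label i"
      "regs t ''one'' = 1" "source i < W" "target i < W" "label i < W" "Suc i < W"
      using base edge_bounds[of i] words by (auto simp: base_def)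
    have "chosen t (Suc i) source target ?P" if "\<not> ?P i"
      using I i that by (auto simp: I_def chosen_def image_less_Suc le_SucI)
    moreover have "chosen (sem pick_out_body t) (Suc i) source target ?P" if "?P i"
      using I i that * bk by (auto simp: body_defs I_def chosen_def image_less_Suc Let_def le_SucI)
    ultimately have "chosen (sem pick_out_body t) (Suc i) source target ?P"
      using * i bk by (cases "?P i") (auto simp: body_defs chosen_def)
    thus "safe W pick_out_body t \<and> I (sem pick_out_body t) \<and>
      m - regs (sem pick_out_body t) ''i'' < m - regs t ''i''"
      using I * i \<open>i < m\<close> by (auto simp: body_defs I_def)
  qed (use assms in \<open>auto simp: I_def base_def chosen_def keeps_base_def body_defs\<close>)
qed

section \<open>Two-colouring the forward and backward edges\<close>

definition partial_map :: "state \<Rightarrow> bool" where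
  "partial_map s \<longleftrightarrow> (\<forall>x. arrs s ''sel'' x \<le> m \<and>
     (0 < arrs s ''sel'' x \<longrightarrow> x < n \<and> arrs s ''f'' x < n))"

lemma partial_map_words:
  assumes "partial_map s"
  shows "arrs s ''sel'' x < W" "0 < arrs s ''sel'' x \<Longrightarrow> arrs s ''f'' x < W"
proof -
  have "arrs s ''sel'' x \<le> m" "0 < arrs s ''sel'' x \<Longrightarrow> arrs s ''f'' x < n"
    using assms by (auto simp: partial_map_def)
  with words show "arrs s ''sel'' x < W" "0 < arrs s ''sel'' x \<Longrightarrow> arrs s ''f'' x < W"
    by linarith+
qed

lemma partial_map_unchanged:
  "partial_map s \<Longrightarrow> unchanged p s t \<Longrightarrow> written_arrs p \<inter> {''sel'', ''f''} = {} \<Longrightarrow> partial_map t"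
  by (auto simp: partial_map_def unchanged_def)

text \<open>The forward edges \<open>x < f x\<close> form a forest and get the classes 1 and 2 by depth, the backward
  edges get 3 and 4, and the loops 5.\<close>

definition forward_coloured :: "state \<Rightarrow> nat \<Rightarrow> bool" where
  "forward_coloured s x \<longleftrightarrow> (\<forall>y. arrs s ''cls'' y \<le> 2 \<and>
     (0 < arrs s ''cls'' y \<longleftrightarrow> x \<le> y \<and> 0 < arrs s ''sel'' y \<and> y < arrs s ''f'' y) \<and>
     (0 < arrs s ''cls'' y \<longrightarrow> arrs s ''cls'' y \<noteq> arrs s ''cls'' (arrs s ''f'' y)))"

lemma runs_forward:
  assumes "base s" "partial_map s" "regs s ''x'' = n" "arrs s ''cls'' = (\<lambda>_. 0)"
  shows "runs W (WhileLess ''z'' ''x'' forward_body) s (9 * n + 1)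
    (\<lambda>s. base s \<and> forward_coloured s 0)"
proof -
  define I :: "state \<Rightarrow> bool" where "I s \<longleftrightarrow> regs s ''x'' \<le> n \<and> forward_coloured s (regs s ''x'')" for s
  show ?thesis
  proof (rule runs_loop[where I = I and \<mu> = "\<lambda>s. regs s ''x''"])
    fix t assume base: "base t" and unch: "unchanged forward_body s t" and I: "I t"
      and less: "regs t ''z'' < regs t ''x''"
    have map: "partial_map t"
      using assms(2) unch by (rule partial_map_unchanged) (simp add: body_defs)
    have reg: "regs t ''z'' = 0" "regs t ''one'' = 1" "regs t ''two'' = 2"
      using base by (auto simp: base_def)
    obtain x where x: "regs t ''x'' = Suc x"
      using less reg by (cases "regs t ''x''") auto
    hence "x < n" "x < W"
      using I words by (auto simp: I_def)
    have sel: "arrs t ''sel'' x < W"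
      using map by (rule partial_map_words)
    have col: "forward_coloured t (Suc x)"
      using I x by (simp add: I_def)
    hence cls: "arrs t ''cls'' y \<le> 2" for y
      by (simp add: forward_coloured_def)
    hence clsW: "arrs t ''cls'' y < W" for y
      using cls[of y] words by linarith
    show "safe W forward_body t \<and> I (sem forward_body t) \<and>
      regs (sem forward_body t) ''x'' < regs t ''x''"
    proof (cases "0 < arrs t ''sel'' x \<and> x < arrs t ''f'' x")
      case True
      hence f: "arrs t ''f'' x < W"
        using partial_map_words[OF map] True by blast
      define c where "c = (if arrs t ''cls'' (arrs t ''f'' x) < 2 then 2 else 1 :: nat)"
      have t': "arrs (sem forward_body t) ''cls'' = (arrs t ''cls'')(x := c)"
        "arrs (sem forward_body t) ''sel'' = arrs t ''sel''"
        "arrs (sem forward_body t) ''f'' = arrs t ''f''" "regs (sem forward_body t) ''x'' = x"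
        using True x reg by (simp_all add: body_defs c_def)
      have c: "0 < c" "c \<le> 2" "arrs t ''cls'' (arrs t ''f'' x) \<noteq> c"
        using cls[of "arrs t ''f'' x"] by (auto simp: c_def)
      have "0 < arrs t ''cls'' y \<longleftrightarrow> Suc x \<le> y \<and> 0 < arrs t ''sel'' y \<and> y < arrs t ''f'' y"
        "0 < arrs t ''cls'' y \<Longrightarrow> arrs t ''cls'' y \<noteq> arrs t ''cls'' (arrs t ''f'' y)" for y
        using col by (auto simp: forward_coloured_def)
      \<comment> \<open>A vertex \<open>y\<close> coloured earlier satisfies
        \<open>x < y < f y\<close>, so colouring \<open>x\<close> affects neither its class nor that
        of \<open>f y\<close>.\<close>
      hence "forward_coloured (sem forward_body t) x"
        using True c cls unfolding forward_coloured_def t' by auto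
      moreover have "safe W forward_body t"
        using x reg True f sel clsW \<open>x < n\<close> \<open>x < W\<close> words by (simp add: body_defs)
      ultimately show ?thesis
        using x t' \<open>x < n\<close> by (simp add: I_def)
    next
      case False
      have "forward_coloured t x"
        using False col unfolding forward_coloured_def Suc_le_eq
        by (metis le_less order_less_imp_le)
      hence "I (sem forward_body t)"
        using False x reg \<open>x < n\<close>
        by (auto simp: body_defs I_def forward_coloured_def)
      moreover have "arrs t ''f'' x < W" if "0 < arrs t ''sel'' x"
        using partial_map_words[OF map] that by blast
      ultimately show ?thesis
        using x reg False sel \<open>x < n\<close> \<open>x < W\<close> by (auto simp: body_defs)
    qed
  next
    have "0 < arrs s ''sel'' y \<Longrightarrow> \<not> n \<le> y" for y
      using assms(2) by (simp add: partial_map_def not_le)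
    thus "I s"
      using assms by (auto simp: I_def forward_coloured_def)
  qed (use assms in \<open>auto simp: I_def base_def keeps_base_def body_defs\<close>)
qed

text \<open>The classes are final below \<open>x\<close>.\<close>

definition class_of :: "state \<Rightarrow> nat \<Rightarrow> nat \<Rightarrow> nat set" where
  "class_of s x c = {y. y < x \<and> 0 < arrs s ''sel'' y \<and> arrs s ''cls'' y = c}"

lemma class_of_le: "finite (class_of s x c)" "card (class_of s x c) \<le> x"
  using card_mono[of "{..<x}" "class_of s x c"] by (auto simp: class_of_def)

lemma class_of_Suc:
  assumes "arrs t ''sel'' = arrs s ''sel''" "\<And>y. y < x \<Longrightarrow> arrs t ''cls'' y = arrs s ''cls'' y"
  shows "class_of t (Suc x) c =
    (if 0 < arrs s ''sel'' x \<and> arrs t ''cls'' x = c then insert x (class_of s x c) else class_of s x c)"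
  using assms by (auto simp: class_of_def less_Suc_eq)

text \<open>One invariant for the ascending loop: at \<open>x = 0\<close> only forward edges have a
  class, at \<open>x = n\<close> every selected vertex has one. By the last clause only a loop joins
  equal classes, so in any other class sources and targets are disjoint.\<close>

definition coloured :: "state \<Rightarrow> nat \<Rightarrow> bool" where
  "coloured s x \<longleftrightarrow> (\<forall>y. arrs s ''cls'' y \<le> 5 \<and>
     (0 < arrs s ''cls'' y \<longleftrightarrow> 0 < arrs s ''sel'' y \<and> (y < x \<or> y < arrs s ''f'' y)) \<and>
     (0 < arrs s ''cls'' y \<longrightarrow> (arrs s ''cls'' y \<le> 2 \<longleftrightarrow> y < arrs s ''f'' y) \<and>
       (arrs s ''cls'' y = 5 \<longleftrightarrow> y = arrs s ''f'' y) \<and>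
       (arrs s ''cls'' y = arrs s ''cls'' (arrs s ''f'' y) \<longrightarrow> y = arrs s ''f'' y)))"

text \<open>\<open>b\<close> is a largest class so far. Its initial value 0 is harmless: in a state
  \<open>coloured\<close> up to \<open>x\<close>, no selected vertex below \<open>x\<close> has
  class 0.\<close>

definition counted :: "state \<Rightarrow> nat \<Rightarrow> bool" where
  "counted s x \<longleftrightarrow> (\<forall>c. arrs s ''ccnt'' c = card (class_of s x c)) \<and>
     (\<forall>c. card (class_of s x c) \<le> regs s ''bestc'') \<and>
     regs s ''bestc'' = card (class_of s x (regs s ''b''))"

lemma runs_backward:
  assumes "base s" "partial_map s" "forward_coloured s 0" "regs s ''x'' = 0"
    "arrs s ''ccnt'' = (\<lambda>_. 0)" "regs s ''bestc'' = 0" "regs s ''b'' = 0"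
  shows "runs W (WhileLess ''x'' ''n'' backward_body) s (20 * n + 1)
    (\<lambda>s. base s \<and> coloured s n \<and> counted s n)"
proof -
  define I :: "state \<Rightarrow> bool" where "I s \<longleftrightarrow> regs s ''x'' \<le> n \<and>
    coloured s (regs s ''x'') \<and> counted s (regs s ''x'')" for s
  show ?thesis
  proof (rule runs_loop[where I = I and \<mu> = "\<lambda>s. n - regs s ''x''"])
    fix t assume base: "base t" and unch: "unchanged backward_body s t" and I: "I t"
      and less: "regs t ''x'' < regs t ''n''"
    have map: "partial_map t"
      using assms(2) unch by (rule partial_map_unchanged) (simp add: body_defs)
    have reg: "regs t ''z'' = 0" "regs t ''one'' = 1" "regs t ''three'' = 3" "regs t ''four'' = 4"
      "regs t ''five'' = 5"
      using base by (auto simp: base_def)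
    obtain x where x: "regs t ''x'' = x" by blast
    hence "x < n" "Suc x < W" "3 < W" "4 < W" "5 < W"
      using less base words by (auto simp: base_def)
    have sel: "arrs t ''sel'' x < W"
      using map by (rule partial_map_words)
    have col: "coloured t x" and cnt: "counted t x"
      using I x by (simp_all add: I_def)
    have cls: "arrs t ''cls'' y \<le> 5" for y
      using col by (simp add: coloured_def)
    hence clsW: "arrs t ''cls'' y < W" for y
      using cls[of y] words by linarith
    have cntW: "Suc (arrs t ''ccnt'' c) < W" for c
      using cnt class_of_le[of t x c] \<open>x < n\<close> words by (auto simp: counted_def)
    define t' where "t' = sem backward_body t"
    have same: "arrs t' ''sel'' = arrs t ''sel''" "arrs t' ''f'' = arrs t ''f''"
      unfolding t'_def by (rule unchanged_arr[OF unchanged_sem]; simp add: body_defs)+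
    have x': "regs t' ''x'' = Suc x"
      using x reg by (simp add: t'_def body_defs)
    show "safe W backward_body t \<and> I (sem backward_body t) \<and>
      n - regs (sem backward_body t) ''x'' < n - regs t ''x''"
    proof (cases "0 < arrs t ''sel'' x")
      case False
      have "arrs t' ''cls'' = arrs t ''cls''" "arrs t' ''ccnt'' = arrs t ''ccnt''"
        "regs t' ''bestc'' = regs t ''bestc''" "regs t' ''b'' = regs t ''b''"
        using False x reg by (auto simp: t'_def body_defs)
      moreover from this have "class_of t' (Suc x) c = class_of t x c" for c
        using False by (subst class_of_Suc[OF same(1)]) auto
      ultimately have "I t'"
        using col cnt x' \<open>x < n\<close> False by (auto simp: I_def coloured_def counted_def same less_Suc_eq)
      moreover have "safe W backward_body t"
        using False x reg sel \<open>Suc x < W\<close> by (simp add: body_defs)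
      ultimately show ?thesis
        using x x' \<open>x < n\<close> by (simp add: t'_def)
    next
      case True
      define y where "y = arrs t ''f'' x"
      have yW: "y < W"
        using partial_map_words[OF map] True by (simp add: y_def)
      define c where "c = (if x < y then arrs t ''cls'' x else if x = y then 5
        else if arrs t ''cls'' y < 4 then 4 else 3)"
      have cases: "x < y \<or> x = y \<or> (y < x \<and> arrs t ''cls'' y < 4) \<or> (y < x \<and> \<not> arrs t ''cls'' y < 4)"
        by linarith
      hence "arrs t' ''cls'' = (arrs t ''cls'')(x := c) \<and>
        arrs t' ''ccnt'' = (arrs t ''ccnt'')(c := Suc (arrs t ''ccnt'' c)) \<and>
        regs t' ''bestc'' =
          (if regs t ''bestc'' < Suc (arrs t ''ccnt'' c) then Suc (arrs t ''ccnt'' c) else regs t ''bestc'') \<and>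
        regs t' ''b'' = (if regs t ''bestc'' < Suc (arrs t ''ccnt'' c) then c else regs t ''b'')"
        using True x reg y_def[symmetric] by (elim disjE) (simp_all add: t'_def backward_body_def c_def)
      hence cls': "arrs t' ''cls'' = (arrs t ''cls'')(x := c)"
        and ccnt': "arrs t' ''ccnt'' = (arrs t ''ccnt'')(c := Suc (arrs t ''ccnt'' c))"
        and best': "regs t' ''bestc'' =
          (if regs t ''bestc'' < Suc (arrs t ''ccnt'' c) then Suc (arrs t ''ccnt'' c) else regs t ''bestc'')"
        "regs t' ''b'' = (if regs t ''bestc'' < Suc (arrs t ''ccnt'' c) then c else regs t ''b'')"
        by blast+
      have old: "0 < arrs t ''cls'' z \<longleftrightarrow> 0 < arrs t ''sel'' z \<and> (z < x \<or> z < arrs t ''f'' z)"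
        "0 < arrs t ''cls'' z \<Longrightarrow> arrs t ''cls'' z \<le> 2 \<longleftrightarrow> z < arrs t ''f'' z"
        "0 < arrs t ''cls'' z \<Longrightarrow> arrs t ''cls'' z = 5 \<longleftrightarrow> z = arrs t ''f'' z"
        "0 < arrs t ''cls'' z \<Longrightarrow> arrs t ''cls'' z = arrs t ''cls'' (arrs t ''f'' z) \<Longrightarrow> z = arrs t ''f'' z"
        for z
        using col unfolding coloured_def by blast+
      have c: "0 < c" "c \<le> 5" "c \<le> 2 \<longleftrightarrow> x < y" "c = 5 \<longleftrightarrow> x = y" "x \<noteq> y \<Longrightarrow> arrs t ''cls'' y \<noteq> c"
      proof -
        consider "x < y" | "x = y" | "y < x" by linarith
        hence "0 < c \<and> c \<le> 5 \<and> (c \<le> 2 \<longleftrightarrow> x < y) \<and> (c = 5 \<longleftrightarrow> x = y) \<and> (x \<noteq> y \<longrightarrow> arrs t ''cls'' y \<noteq> c)"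
        proof cases
          case 1
          with old[of x, folded y_def] cls[of x] True show ?thesis
            by (auto simp: c_def)
        qed (auto simp: c_def)
        thus "0 < c" "c \<le> 5" "c \<le> 2 \<longleftrightarrow> x < y" "c = 5 \<longleftrightarrow> x = y" "x \<noteq> y \<Longrightarrow> arrs t ''cls'' y \<noteq> c"
          by blast+
      qed
      \<comment> \<open>Recolouring \<open>x\<close> could only harm a classified \<open>z\<close>
        with \<open>f z = x\<close>. Such a \<open>z\<close> lies below \<open>x\<close> and has a
        forward class; equality with \<open>c\<close> would make \<open>x\<close> forward too, but
        then its old class was kept and already differed from that of \<open>z\<close>.\<close>
      have into: "arrs t ''cls'' z \<noteq> c" if z: "z \<noteq> x" "0 < arrs t ''cls'' z" "arrs t ''f'' z = x" for z
      proof
        assume eq: "arrs t ''cls'' z = c"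
        have "arrs t ''cls'' z \<le> 2"
          using old(1,2)[of z] z by auto
        with eq c(3) have "arrs t ''cls'' x = c"
          by (simp add: c_def)
        with old(4)[of z] z eq show False by simp
      qed
      have "coloured t' (Suc x)"
        unfolding coloured_def same cls'
      proof (intro allI, goal_cases)
        case (1 z)
        show ?case
        proof (cases "z = x")
          case True
          with c \<open>0 < arrs t ''sel'' x\<close> show ?thesis
            by (auto simp: y_def[symmetric])
        next
          case False
          define w where "w = arrs t ''f'' z"
          note old' = old[of z, folded w_def]
          have less: "z < Suc x \<longleftrightarrow> z < x" and z: "((arrs t ''cls'')(x := c)) z = arrs t ''cls'' z"
            using False by auto
          show ?thesis
          proof (cases "arrs t ''cls'' z = 0")
            case True
            with old'(1) have "\<not> (0 < arrs t ''sel'' z \<and> (z < x \<or> z < w))"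
              by simp
            with True show ?thesis
              unfolding w_def[symmetric] z less by simp
          next
            case nonzero: False
            hence "z = w" if "arrs t ''cls'' z = ((arrs t ''cls'')(x := c)) w"
              using that old'(4) into[OF False, folded w_def] by (cases "w = x") simp_all
            with nonzero old'(1-3) cls[of z] show ?thesis
              unfolding w_def[symmetric] z less by blast
          qed
        qed
      qed
      have "class_of t' (Suc x) c' =
        (if c' = c then insert x (class_of t x c') else class_of t x c')" for c'
        using True cls' by (subst class_of_Suc[OF same(1)]) auto
      moreover have "x \<notin> class_of t x c'" for c'
        by (simp add: class_of_def)
      ultimately have card: "card (class_of t' (Suc x) c') =
        (if c' = c then Suc (card (class_of t x c')) else card (class_of t x c'))" for c'
        using class_of_le(1)[of t x] by simp
      have old: "arrs t ''ccnt'' c' = card (class_of t x c')" "card (class_of t x c') \<le> regs t ''bestc''"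
        "regs t ''bestc'' = card (class_of t x (regs t ''b''))" for c'
        using cnt unfolding counted_def by blast+
      have "counted t' (Suc x)"
        unfolding counted_def
      proof (intro conjI allI)
        fix c' show "card (class_of t' (Suc x) c') \<le> regs t' ''bestc''"
          using old(2)[of c'] unfolding best' card old(1) by (simp split: if_split)
      next
        show "regs t' ''bestc'' = card (class_of t' (Suc x) (regs t' ''b''))"
          using old(3) old(2)[of c] unfolding best' card old(1) by (auto split: if_split)
      qed (simp add: ccnt' card old(1))
      hence "I t'"
        using x' \<open>x < n\<close> \<open>coloured t' (Suc x)\<close> by (simp add: I_def)
      moreover have "safe W backward_body t"
        using cases True x reg sel yW clsW cntW Suc_lessD[OF cntW] \<open>3 < W\<close> \<open>4 < W\<close> \<open>5 < W\<close> \<open>Suc x < W\<close> y_def[symmetric]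
        by (elim disjE) (simp_all add: backward_body_def)
      ultimately show ?thesis
        using x x' \<open>x < n\<close> by (simp add: t'_def)
    qed
  next
    show "I s"
      using assms by (auto simp: I_def coloured_def forward_coloured_def counted_def class_of_def
          intro: order_trans)
  qed (use assms in \<open>auto simp: I_def base_def keeps_base_def body_defs\<close>)
qed

section \<open>Output of the largest class\<close>

definition output_of :: "state \<Rightarrow> nat \<Rightarrow> nat edge list" where
  "output_of s x = map (\<lambda>y. es ! (arrs s ''sel'' y - 1))
     (filter (\<lambda>y. y \<in> class_of s n (regs s ''b'')) [0..<x])"

text \<open>The loop writes neither classes nor selections, so \<open>output_of\<close> can refer to
  the state \<open>s\<close> before it; each round then appends at most one edge.\<close>

lemma runs_output:
  assumes "base s" "partial_map s" "coloured s n" "regs s ''x'' = 0" "regs s ''out_m'' = 0"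
  shows "runs W (WhileLess ''x'' ''n'' output_body) s (20 * n + 1)
    (\<lambda>t. base t \<and> output_edges t = output_of s n)"
proof -
  define I :: "state \<Rightarrow> bool" where "I t \<longleftrightarrow> regs t ''x'' \<le> n \<and>
    output_edges t = output_of s (regs t ''x'')" for t
  show ?thesis
  proof (rule runs_loop[where I = I and \<mu> = "\<lambda>s. n - regs s ''x''"])
    fix t assume base: "base t" and unch: "unchanged output_body s t" and I: "I t"
      and less: "regs t ''x'' < regs t ''n''"
    have reg: "regs t ''z'' = 0" "regs t ''one'' = 1"
      using base by (auto simp: base_def)
    have b: "regs t ''b'' = regs s ''b''" and sel: "arrs t ''sel'' = arrs s ''sel''"
      and cls: "arrs t ''cls'' = arrs s ''cls''"
      using unch by (auto simp: unchanged_def body_defs)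
    obtain x where x: "regs t ''x'' = x" by blast
    hence "x < n" "Suc x < W"
      using less base words by (auto simp: base_def)
    have selm: "arrs s ''sel'' x \<le> m"
      using assms(2) by (simp add: partial_map_def)
    have clsW: "arrs s ''cls'' x \<le> 5"
      using assms(3) by (simp add: coloured_def)
    have out: "output_edges t = output_of s x"
      using I x by (simp add: I_def)
    \<comment> \<open>At most one edge per vertex is written, which keeps the increment of
      \<open>out_m\<close> below \<open>W\<close>.\<close>
    have "regs t ''out_m'' = length (output_edges t)"
      by (simp add: output_edges_def)
    also have "\<dots> \<le> x"
      unfolding out output_of_def using length_filter_le[of _ "[0..<x]"] by simp
    finally have out_m: "regs t ''out_m'' \<le> x" .
    show "safe W output_body t \<and> I (sem output_body t) \<and>
      n - regs (sem output_body t) ''x'' < n - regs t ''x''"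
    proof (cases "x \<in> class_of s n (regs s ''b'')")
      case True
      then obtain j where j: "arrs s ''sel'' x = Suc j" "arrs s ''cls'' x = regs s ''b''"
        by (auto simp: class_of_def gr0_conv_Suc)
      hence "j < m"
        using selm by simp
      have *: "arrs t ''src'' j = source j" "arrs t ''dst'' j = target j" "arrs t ''lab'' j = label j"
        "source j < W" "target j < W" "label j < W"
        using base \<open>j < m\<close> edge_bounds[of j] words by (auto simp: base_def)
      have "output_edges (sem output_body t) = output_edges t @ [(source j, target j, label j)]"
        using x reg b sel cls j * by (simp add: body_defs output_edges_def)
      also have "\<dots> = output_of s (Suc x)"
        using True j by (simp add: out output_of_def source_def target_def label_def)
      finally show ?thesis
        using x reg b sel cls j * \<open>x < n\<close> \<open>Suc x < W\<close> \<open>j < m\<close> words out_m clsW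
        by (simp add: body_defs I_def)
    next
      case False
      hence ne: "\<not> 0 < arrs s ''sel'' x \<or> arrs s ''cls'' x \<noteq> regs s ''b''"
        using \<open>x < n\<close> by (simp add: class_of_def)
      hence "output_edges (sem output_body t) = output_edges t"
        using x reg b sel cls by (auto simp: body_defs output_edges_def)
      also have "\<dots> = output_of s (Suc x)"
        using False by (simp add: out output_of_def)
      finally show ?thesis
        using ne x reg b sel cls \<open>x < n\<close> \<open>Suc x < W\<close> words selm clsW
        by (auto simp: body_defs I_def)
    qed
  qed (use assms in \<open>auto simp: I_def base_def keeps_base_def body_defs output_edges_def output_of_def\<close>)
qed

section \<open>Composition of the phases and the approximation guarantee\<close>

definition domain :: "state \<Rightarrow> nat set" where
  "domain s = {x. 0 < arrs s ''sel'' x}"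

text \<open>The interface between selection and colouring: the domain is at least as large as both
  quantities in the upper bound on the optimum, in whichever mode.\<close>

definition suited :: "state \<Rightarrow> bool" where
  "suited s \<longleftrightarrow>
     (chosen s m target source (\<lambda>_. True) \<or> (\<exists>l. chosen s m source target (\<lambda>j. label j = l))) \<and>
     card (target ` {..<m}) \<le> card (domain s) \<and> (\<forall>k. card (sources {..<m} k) \<le> card (domain s))"

lemma domain_chosen: "chosen s m a b P \<Longrightarrow> domain s = a ` {j. j < m \<and> P j}"
  by (auto simp: chosen_def domain_def)

lemma runs_select:
  assumes "base s"
    and fresh: "fresh {''i'', ''tcnt'', ''best'', ''bk''} {''head'', ''inn'', ''cnt'', ''stamp'', ''sel''} s"
  shows "runs W select_com s (20 * n + 40 * m + 10) (\<lambda>t. base t \<and> suited t)"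
proof -
  \<comment> \<open>The time is a nested sum mirroring the \<open>Seq\<close> structure, so that the
    rules for \<open>runs\<close> unify with it.\<close>
  have "runs W select_com s ((11 * m + 1) + (1 + (1 + ((20 * (n + m) + 1) + (1 + (1 + (9 * m + 1)))))))
    (\<lambda>t. base t \<and> suited t)"
    unfolding select_com_def
  proof (rule runs_Seq)
    show "runs W (WhileLess ''i'' ''m'' link_body) s (11 * m + 1)
      (\<lambda>s. base s \<and> linked s \<and> regs s ''tcnt'' = card (target ` {..<m}))"
      using assms by (intro runs_link) (auto simp: fresh_def)
  next
    fix s1 assume unch: "unchanged (WhileLess ''i'' ''m'' link_body) s s1"
      and s1: "base s1 \<and> linked s1 \<and> regs s1 ''tcnt'' = card (target ` {..<m})"
    have fresh1: "fresh {''best'', ''bk''} {''cnt'', ''stamp'', ''sel''} s1"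
      by (rule fresh_unchanged[OF unch, where R' = "{''i'', ''tcnt''}" and A' = "{''head'', ''inn''}"])
        (use fresh in \<open>auto simp: body_defs fresh_def\<close>)
    have head: "arrs s1 ''head'' 0 = previous 0 m" "previous 0 m < W" "regs s1 ''z'' = 0"
      using s1 previous_le[of 0 m] words by (auto simp: linked_def base_def)
    define s2 where "s2 = s1\<lparr>regs := (regs s1)(''u'' := 0, ''p'' := previous 0 m)\<rparr>"
    have "runs W (WhileLess ''u'' ''n'' count_body ;; ''i'' ::= Reg ''z'' ;;
        IfLess ''best'' ''tcnt'' (WhileLess ''i'' ''m'' pick_in_body) (WhileLess ''i'' ''m'' pick_out_body))
      s2 ((20 * (n + m) + 1) + (1 + (1 + (9 * m + 1)))) (\<lambda>t. base t \<and> suited t)"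
    proof (rule runs_Seq)
      show "runs W (WhileLess ''u'' ''n'' count_body) s2 (20 * (n + m) + 1)
        (\<lambda>s. base s \<and> regs s ''best'' = card (sources {..<m} (regs s ''bk'')) \<and>
          (\<forall>k. card (sources {..<m} k) \<le> regs s ''best''))"
        using s1 fresh1 by (intro runs_count) (auto simp: s2_def fresh_def linked_def base_def)
    next
      fix s3 assume unch: "unchanged (WhileLess ''u'' ''n'' count_body) s2 s3"
        and s3: "base s3 \<and> regs s3 ''best'' = card (sources {..<m} (regs s3 ''bk'')) \<and>
          (\<forall>k. card (sources {..<m} k) \<le> regs s3 ''best'')"
      have sel: "arrs s3 ''sel'' = (\<lambda>_. 0)" and tcnt: "regs s3 ''tcnt'' = card (target ` {..<m})"
        using unchanged_arr[OF unch, of "''sel''"] unchanged_reg[OF unch, of "''tcnt''"] s1 fresh1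
        by (auto simp: body_defs s2_def fresh_def)
      define s4 where "s4 = s3\<lparr>regs := (regs s3)(''i'' := 0)\<rparr>"
      have s4: "base s4" "regs s4 ''i'' = 0" "arrs s4 ''sel'' = (\<lambda>_. 0)"
        using s3 sel by (auto simp: s4_def base_def)
      have "runs W (IfLess ''best'' ''tcnt'' (WhileLess ''i'' ''m'' pick_in_body)
        (WhileLess ''i'' ''m'' pick_out_body)) s4 (1 + (9 * m + 1)) (\<lambda>t. base t \<and> suited t)"
      proof (rule runs_IfLess)
        assume "regs s4 ''best'' < regs s4 ''tcnt''"
        hence "card (sources {..<m} k) \<le> card (target ` {..<m})" for k
          using s3 tcnt by (auto simp: s4_def intro: order_trans less_imp_le)
        thus "runs W (WhileLess ''i'' ''m'' pick_in_body) s4 (9 * m + 1) (\<lambda>t. base t \<and> suited t)"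
          by (intro runs_weaken[OF runs_pick_in[OF s4]])
            (auto simp: suited_def lessThan_def domain_chosen[where P = "\<lambda>_. True", simplified])
      next
        assume "\<not> regs s4 ''best'' < regs s4 ''tcnt''"
        hence "card (target ` {..<m}) \<le> card (sources {..<m} (regs s4 ''bk''))"
          "\<forall>k. card (sources {..<m} k) \<le> card (sources {..<m} (regs s4 ''bk''))"
          using s3 tcnt by (auto simp: s4_def)
        thus "runs W (WhileLess ''i'' ''m'' pick_out_body) s4 (9 * m + 1) (\<lambda>t. base t \<and> suited t)"
          by (intro runs_weaken[OF runs_pick_out[OF s4]])
            (auto simp: suited_def domain_chosen sources_def)
      qed
      thus "runs W (''i'' ::= Reg ''z'' ;;
          IfLess ''best'' ''tcnt'' (WhileLess ''i'' ''m'' pick_in_body) (WhileLess ''i'' ''m'' pick_out_body))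
        s3 (1 + (1 + (9 * m + 1))) (\<lambda>t. base t \<and> suited t)"
        using s3 words by (intro runs_Assign_Seq) (auto simp: s4_def base_def)
    qed
    thus "runs W (''u'' ::= Reg ''z'' ;; ''p'' ::= Load ''head'' ''u'' ;; WhileLess ''u'' ''n'' count_body ;;
        ''i'' ::= Reg ''z'' ;;
        IfLess ''best'' ''tcnt'' (WhileLess ''i'' ''m'' pick_in_body) (WhileLess ''i'' ''m'' pick_out_body))
      s1 (1 + (1 + ((20 * (n + m) + 1) + (1 + (1 + (9 * m + 1)))))) (\<lambda>t. base t \<and> suited t)"
      using head words by (intro runs_Assign_Seq) (simp_all add: s2_def)
  qed
  thus ?thesis
    by (rule runs_weaken) auto
qed

text \<open>In both modes the two ends of a chosen edge are vertices, which is what the colouring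
  loops need.\<close>

lemma suited_partial_map: "suited s \<Longrightarrow> partial_map s"
proof -
  have "partial_map s" if "chosen s m a b P" "\<And>j. j < m \<Longrightarrow> a j < n" "\<And>j. j < m \<Longrightarrow> b j < n" for a b P
    unfolding partial_map_def
  proof (intro allI conjI impI)
    fix x
    show le: "arrs s ''sel'' x \<le> m"
      using that(1) by (simp add: chosen_def)
    assume pos: "0 < arrs s ''sel'' x"
    with le have "arrs s ''sel'' x - 1 < m" by linarith
    moreover have "a (arrs s ''sel'' x - 1) = x" "b (arrs s ''sel'' x - 1) = arrs s ''f'' x"
      using that(1) pos unfolding chosen_def Let_def by blast+
    ultimately show "x < n" "arrs s ''f'' x < n"
      using that(2,3)[of "arrs s ''sel'' x - 1"] by simp_all
  qed
  thus "suited s \<Longrightarrow> partial_map s"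
    using edge_bounds unfolding suited_def by blast
qed

lemma suited_cong: "arrs t ''sel'' = arrs s ''sel'' \<Longrightarrow> arrs t ''f'' = arrs s ''f'' \<Longrightarrow> suited t \<longleftrightarrow> suited s"
  by (simp add: suited_def chosen_def domain_def)

lemma suited_update: "suited (s\<lparr>regs := r\<rparr>) \<longleftrightarrow> suited s"
  by (rule suited_cong) simp_all

lemma runs_colour:
  assumes "base s" "suited s"
    and fresh: "fresh {''bestc'', ''b'', ''out_m''} {''cls'', ''ccnt''} s"
  shows "runs W colour_com s (50 * n + 10)
    (\<lambda>t. \<exists>s'. suited s' \<and> coloured s' n \<and> counted s' n \<and> output_edges t = output_of s' n)"
    (is "runs W _ s _ ?Q")
proof -
  have n: "n < W" "0 < W"
    using words by auto
  have "runs W colour_com s (1 + ((9 * n + 1) + (1 + ((20 * n + 1) + (1 + (20 * n + 1)))))) ?Q"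
    unfolding colour_com_def
  proof (rule runs_Assign_Seq)
    show "rhs_val (Reg ''n'') s < W"
      using assms(1) n by (simp add: base_def)
    define s1 where "s1 = s\<lparr>regs := (regs s)(''x'' := rhs_val (Reg ''n'') s)\<rparr>"
    have s1: "base s1" "suited s1" "regs s1 ''x'' = n"
      using assms by (auto simp: s1_def base_def suited_update)
    have fresh1: "fresh {''bestc'', ''b'', ''out_m''} {''cls'', ''ccnt''} s1"
      using fresh by (simp add: fresh_def s1_def)
    show "runs W (WhileLess ''z'' ''x'' forward_body ;;
        ''x'' ::= Reg ''z'' ;; WhileLess ''x'' ''n'' backward_body ;;
        ''x'' ::= Reg ''z'' ;; WhileLess ''x'' ''n'' output_body)
      s1 ((9 * n + 1) + (1 + ((20 * n + 1) + (1 + (20 * n + 1))))) ?Q"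
    proof (rule runs_Seq)
      show "runs W (WhileLess ''z'' ''x'' forward_body) s1 (9 * n + 1)
        (\<lambda>s. base s \<and> forward_coloured s 0)"
        using s1 fresh1 suited_partial_map by (intro runs_forward) (auto simp: fresh_def)
    next
      fix s2 assume unch: "unchanged (WhileLess ''z'' ''x'' forward_body) s1 s2"
        and s2: "base s2 \<and> forward_coloured s2 0"
      have fresh2: "fresh {''bestc'', ''b'', ''out_m''} {''ccnt''} s2"
        by (rule fresh_unchanged[OF unch, where R' = "{}" and A' = "{''cls''}"])
          (use fresh1 in \<open>auto simp: body_defs fresh_def\<close>)
      have "suited s2"
        using s1(2) suited_cong[of s2 s1] unchanged_arr[OF unch] by (simp add: body_defs)
      define s3 where "s3 = s2\<lparr>regs := (regs s2)(''x'' := 0)\<rparr>"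
      have s3: "base s3" "suited s3" "forward_coloured s3 0" "regs s3 ''x'' = 0"
        using s2 \<open>suited s2\<close> by (auto simp: s3_def base_def forward_coloured_def suited_update)
      have fresh3: "fresh {''bestc'', ''b'', ''out_m''} {''ccnt''} s3"
        using fresh2 by (simp add: fresh_def s3_def)
      have "runs W (WhileLess ''x'' ''n'' backward_body ;;
          ''x'' ::= Reg ''z'' ;; WhileLess ''x'' ''n'' output_body)
        s3 ((20 * n + 1) + (1 + (20 * n + 1))) ?Q"
      proof (rule runs_Seq)
        show "runs W (WhileLess ''x'' ''n'' backward_body) s3 (20 * n + 1)
          (\<lambda>s. base s \<and> coloured s n \<and> counted s n)"
          using s3 fresh3 suited_partial_map by (intro runs_backward) (auto simp: fresh_def)
      next
        fix s4 assume unch: "unchanged (WhileLess ''x'' ''n'' backward_body) s3 s4"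
          and s4: "base s4 \<and> coloured s4 n \<and> counted s4 n"
        have out_m: "regs s4 ''out_m'' = 0"
          using unchanged_reg[OF unch, of "''out_m''"] fresh3 by (simp add: body_defs fresh_def)
        have "suited s4"
          using s3(2) suited_cong[of s4 s3] unchanged_arr[OF unch] by (simp add: body_defs)
        define s5 where "s5 = s4\<lparr>regs := (regs s4)(''x'' := 0)\<rparr>"
        have s5: "base s5" "suited s5" "coloured s5 n" "counted s5 n" "regs s5 ''x'' = 0" "regs s5 ''out_m'' = 0"
          using s4 \<open>suited s4\<close> out_m
          by (auto simp: suited_update s5_def base_def coloured_def counted_def class_of_def)
        have "runs W (WhileLess ''x'' ''n'' output_body) s5 (20 * n + 1) ?Q"
          using s5 suited_partial_map by (intro runs_weaken[OF runs_output]) auto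
        thus "runs W (''x'' ::= Reg ''z'' ;; WhileLess ''x'' ''n'' output_body) s4 (1 + (20 * n + 1)) ?Q"
          using s4 n by (intro runs_Assign_Seq) (auto simp: s5_def base_def)
      qed
      thus "runs W (''x'' ::= Reg ''z'' ;; WhileLess ''x'' ''n'' backward_body ;;
          ''x'' ::= Reg ''z'' ;; WhileLess ''x'' ''n'' output_body)
        s2 (1 + ((20 * n + 1) + (1 + (20 * n + 1)))) ?Q"
        using s2 n by (intro runs_Assign_Seq) (auto simp: s3_def base_def)
    qed
  qed
  thus ?thesis
    by (rule runs_weaken) auto
qed

text \<open>With \<open>d = card (domain s)\<close>, the optimum is at most
  \<open>\<sigma> * (d + d)\<close>, and the largest of five classes has at least
  \<open>d / 5\<close> edges; hence the factor 10.\<close>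

lemma output_of_correct:
  assumes suited: "suited s" and "coloured s n" "counted s n"
  defines "F \<equiv> set (output_of s n)"
  shows "distinct (output_of s n)" "F \<subseteq> set es" "wheeler_graph {..<n} F"
    "ws_opt {..<n} (set es) \<le> 10 * \<sigma> * card F"
proof -
  define K where "K = class_of s n (regs s ''b'')"
  define e where "e y = es ! (arrs s ''sel'' y - 1)" for y
  define f where "f = arrs s ''f''"
  have out: "output_of s n = map e (filter (\<lambda>y. y \<in> K) [0..<n])"
    by (simp add: output_of_def e_def K_def)
  have F: "F = e ` K"
    unfolding F_def out by (auto simp: K_def class_of_def)
  have fin: "finite K"
    by (simp add: K_def class_of_le)
  have e_eq: "e y = (source (arrs s ''sel'' y - 1), target (arrs s ''sel'' y - 1), label (arrs s ''sel'' y - 1))" for y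
    by (simp add: e_def source_def target_def label_def)
  have sel: "arrs s ''sel'' y - 1 < m" "0 < arrs s ''sel'' y" if "y \<in> K" for y
  proof -
    show "0 < arrs s ''sel'' y"
      using that by (simp add: K_def class_of_def)
    moreover have "arrs s ''sel'' y \<le> m"
      using suited_partial_map[OF suited] by (simp add: partial_map_def)
    ultimately show "arrs s ''sel'' y - 1 < m" by linarith
  qed
  have cls: "arrs s ''cls'' y = regs s ''b''" "0 < arrs s ''cls'' y" if "y \<in> K" for y
    using that \<open>coloured s n\<close> by (auto simp: K_def class_of_def coloured_def)
  \<comment> \<open>Within one class, \<open>f y\<close> in \<open>K\<close> forces a loop, and
    class 5 consists exactly of the loops. So \<open>b = 5\<close> gives only loops, and any other
    \<open>b\<close> leaves no \<open>f y\<close> in \<open>K\<close>.\<close>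
  have shape: "(\<forall>y\<in>K. f y = y) \<or> (\<forall>y\<in>K. f y \<notin> K)"
  proof -
    have "f y = y" if "y \<in> K" "f y \<in> K" for y
      using cls[OF that(1)] cls[OF that(2)] \<open>coloured s n\<close> unfolding coloured_def f_def by metis
    moreover have "f y = y \<longleftrightarrow> regs s ''b'' = 5" if "y \<in> K" for y
      using cls[OF that] \<open>coloured s n\<close> unfolding coloured_def f_def by metis
    ultimately show ?thesis by blast
  qed
  \<comment> \<open>\<open>y\<close> can be read off \<open>e y\<close>, as its target in the first
    mode and its source in the second, so \<open>e\<close> is injective on \<open>K\<close>.\<close>
  have modes: "inj_on e K \<and> wheeler_graph {..<n} F"
    using suited unfolding suited_def
  proof (elim conjE disjE exE)
    assume "chosen s m target source (\<lambda>_. True)"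
    hence e: "e y = (f y, y, label (arrs s ''sel'' y - 1))" if "y \<in> K" for y
      using sel[OF that] by (auto simp: e_eq chosen_def Let_def f_def)
    have "wheeler_graph {..<n} F"
    proof (rule wheeler_graph_unique_in)
      fix u k u' k' v assume "(u, v, k) \<in> F" "(u', v, k') \<in> F"
      thus "u = u' \<and> k = k'"
        by (auto simp: F e)
    next
      show "(\<forall>u v k. (u, v, k) \<in> F \<longrightarrow> u = v) \<or>
        (\<forall>u v k u' v' k'. (u, v, k) \<in> F \<and> (u', v', k') \<in> F \<longrightarrow> u \<noteq> v')"
        using shape by (auto simp: F e)
    qed (simp add: F fin)
    moreover have "inj_on e K"
      by (auto simp: inj_on_def e)
    ultimately show ?thesis by blast
  next
    fix l assume "chosen s m source target (\<lambda>j. label j = l)"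
    hence e: "e y = (y, f y, l)" if "y \<in> K" for y
      using sel[OF that] by (auto simp: e_eq chosen_def Let_def f_def)
    have "wheeler_graph {..<n} F"
    proof (rule wheeler_graph_unique_out)
      show "(\<forall>u v k. (u, v, k) \<in> F \<longrightarrow> u = v) \<or>
        (\<forall>u v k u' v' k'. (u, v, k) \<in> F \<and> (u', v', k') \<in> F \<longrightarrow> u \<noteq> v')"
        using shape by (auto simp: F e)
    qed (auto simp: F e fin)
    moreover have "inj_on e K"
      by (auto simp: inj_on_def e)
    ultimately show ?thesis by blast
  qed
  show "wheeler_graph {..<n} F"
    using modes by blast
  show "distinct (output_of s n)"
    unfolding out using modes by (auto simp: distinct_map intro: inj_on_subset)
  show "F \<subseteq> set es"
    using sel by (auto simp: F e_def)
  have "domain s \<subseteq> (\<Union>c\<in>{1..5}. class_of s n c)"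
    using suited_partial_map[OF suited] \<open>coloured s n\<close>
    by (auto simp: domain_def class_of_def coloured_def partial_map_def Suc_le_eq)
  hence "card (domain s) \<le> card (\<Union>c\<in>{1..5}. class_of s n c)"
    by (intro card_mono) (auto simp: class_of_le)
  also have "\<dots> \<le> (\<Sum>c\<in>{1..5}. card (class_of s n c))"
    by (rule card_UN_le) simp
  also have "\<dots> \<le> (\<Sum>c\<in>{1..5::nat}. card K)"
    using \<open>counted s n\<close> by (intro sum_mono) (auto simp: counted_def K_def)
  also have "\<dots> = 5 * card F"
    using modes by (simp add: F card_image)
  finally have domain: "card (domain s) \<le> 5 * card F" .
  have es: "(u, v, k) \<in> set es \<longleftrightarrow> (\<exists>j<m. u = source j \<and> v = target j \<and> k = label j)" for u v k
    by (auto simp: in_set_conv_nth source_def target_def label_def prod_eq_iff)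
  have "ws_opt {..<n} (set es) \<le> \<sigma> * (card (domain s) + card (domain s))"
  proof (rule ws_opt_le)
    show "labeled_graph {..<n} \<sigma> (set es)"
      using edges by (simp add: labeled_graph_def)
  next
    fix k
    have "{u. \<exists>v. (u, v, k) \<in> set es} = sources {..<m} k"
      by (auto simp: es sources_def)
    thus "card {u. \<exists>v. (u, v, k) \<in> set es} \<le> card (domain s)"
      using suited by (simp add: suited_def)
  next
    have "{v. \<exists>u k. (u, v, k) \<in> set es} = target ` {..<m}"
      by (auto simp: es)
    thus "card {v. \<exists>u k. (u, v, k) \<in> set es} \<le> card (domain s)"
      using suited by (simp add: suited_def)
  qed
  also have "\<dots> \<le> \<sigma> * (5 * card F + 5 * card F)"
    using domain by (intro mult_le_mono add_mono) auto
  finally show "ws_opt {..<n} (set es) \<le> 10 * \<sigma> * card F"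
    by simp
qed

lemma runs_wheeler:
  "runs W wheeler_com (input_state n \<sigma> es) (70 * n + 40 * m + 25)
    (\<lambda>t. \<exists>F. lists_edges (output_edges t) F \<and> F \<subseteq> set es \<and> wheeler_graph {..<n} F \<and>
      ws_opt {..<n} (set es) \<le> 10 * \<sigma> * card F)" (is "runs W _ ?s _ ?Q")
proof -
  let ?R = "{''i'', ''tcnt'', ''best'', ''bk''} \<union> {''bestc'', ''b'', ''out_m''}"
  let ?A = "{''head'', ''inn'', ''cnt'', ''stamp'', ''sel''} \<union> {''cls'', ''ccnt''}"
  have "runs W wheeler_com ?s
    (5 + ((20 * n + 40 * m + 10) + (50 * n + 10))) ?Q"
    unfolding wheeler_com_def
  proof (rule runs_Seq)
    show "runs W init ?s 5 (\<lambda>s. base s \<and> fresh ?R ?A s)"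
      using words
      by (intro runs_safe)
        (auto simp: init_def base_def fresh_def input_state_def array_of_def source_def target_def
          label_def case_prod_beta)
  next
    fix s1 assume s1: "base s1 \<and> fresh ?R ?A s1"
    show "runs W (select_com ;; colour_com) s1 ((20 * n + 40 * m + 10) + (50 * n + 10)) ?Q"
    proof (rule runs_Seq)
      show "runs W select_com s1 (20 * n + 40 * m + 10) (\<lambda>t. base t \<and> suited t)"
        using s1 by (intro runs_select) (auto simp: fresh_def)
    next
      fix s2 assume unch: "unchanged select_com s1 s2" and s2: "base s2 \<and> suited s2"
      have "fresh {''bestc'', ''b'', ''out_m''} {''cls'', ''ccnt''} s2"
        by (rule fresh_unchanged[OF unch, where R' = "{''i'', ''tcnt'', ''best'', ''bk''}"
              and A' = "{''head'', ''inn'', ''cnt'', ''stamp'', ''sel''}"])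
          (use s1 in \<open>auto simp: select_com_def body_defs fresh_def\<close>)
      with s2 have "runs W colour_com s2 (50 * n + 10)
        (\<lambda>t. \<exists>s'. suited s' \<and> coloured s' n \<and> counted s' n \<and> output_edges t = output_of s' n)"
        by (intro runs_colour) auto
      thus "runs W colour_com s2 (50 * n + 10) ?Q"
      proof (rule runs_weaken)
        fix t assume "\<exists>s'. suited s' \<and> coloured s' n \<and> counted s' n \<and> output_edges t = output_of s' n"
        then obtain s' where "suited s'" "coloured s' n" "counted s' n" "output_edges t = output_of s' n"
          by blast
        thus "?Q t"
          using output_of_correct[of s'] by (intro exI[of _ "set (output_of s' n)"]) (simp add: lists_edges_def)
      qed simp
    qed
  qed
  thus ?thesis
    by (rule runs_weaken) auto
qed

end

theorem theorem19:
  shows "\<exists>(alg :: com) (c :: real) (C :: nat). c > 0 \<and>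
    (\<forall>(n :: nat) (\<sigma> :: nat) (E :: nat edge set) (es :: nat edge list) (W :: nat).
       labeled_graph {..<n} \<sigma> E \<and> lists_edges es E \<and> W \<ge> C * (n + card E + \<sigma> + 1) \<longrightarrow>
       (\<exists>t s E''.
          exec W alg (input_state n \<sigma> es) t s \<and>
          t \<le> C * (n + card E + 1) \<and>
          lists_edges (output_edges s) E'' \<and>
          E'' \<subseteq> E \<and>
          wheeler_graph {..<n} E'' \<and>
          real (card E'') \<ge> c / real \<sigma> * real (ws_opt {..<n} E)))"
proof (rule exI[of _ "wheeler_com"], rule exI[of _ "1 / 10"], rule exI[of _ 70],
    intro conjI allI impI)
  \<comment> \<open>The ratio inverts the factor 10 of \<open>output_of_correct\<close>. The
    constant 70 dominates the coefficients 70, 40 and 25 of the running time, and also suffices for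
    \<open>words\<close>.\<close>
  show "(0::real) < 1 / 10" by simp
next
  fix n \<sigma> :: nat and E :: "nat edge set" and es :: "nat edge list" and W :: nat
  assume asm: "labeled_graph {..<n} \<sigma> E \<and> lists_edges es E \<and> W \<ge> 70 * (n + card E + \<sigma> + 1)"
  hence E: "E = set es" "card E = length es" "distinct es"
    unfolding lists_edges_def by (auto simp: distinct_card)
  interpret ws_input n \<sigma> es W
    using asm E by unfold_locales (auto simp: labeled_graph_def)
  from runs_wheeler obtain t s F where
    run: "exec W wheeler_com (input_state n \<sigma> es) t s"
      "t \<le> 70 * n + 40 * length es + 25" and
    F: "lists_edges (output_edges s) F" "F \<subseteq> set es" "wheeler_graph {..<n} F"
      "ws_opt {..<n} (set es) \<le> 10 * \<sigma> * card F"
    unfolding runs_def by blast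
  have "real (ws_opt {..<n} E) \<le> real (10 * \<sigma> * card F)"
    using F(4) E(1) by (simp only: of_nat_le_iff)
  \<comment> \<open>For \<open>\<sigma> = 0\<close> the quotient is 0 by the convention on division
    by zero, and the claim is trivial.\<close>
  hence "1 / 10 / real \<sigma> * real (ws_opt {..<n} E) \<le> real (card F)"
    by (cases "\<sigma> = 0") (auto simp: field_simps)
  moreover have "t \<le> 70 * (n + card E + 1)"
    using run(2) E(2) by simp
  ultimately show "\<exists>t s E''.
          exec W wheeler_com (input_state n \<sigma> es) t s \<and>
          t \<le> 70 * (n + card E + 1) \<and>
          lists_edges (output_edges s) E'' \<and>
          E'' \<subseteq> E \<and>
          wheeler_graph {..<n} E'' \<and>
          real (card E'') \<ge> 1 / 10 / real \<sigma> * real (ws_opt {..<n} E)"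
    using run(1) F(1-3) E(1) by blast
qed

end
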